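(* Consider a $K$-armed stochastic bandit with sub-Gaussian reward distributions $\nu_1,\dots,\nu_K$ and $\mu^{(\star)}=\max_i\mu^{(i)}=0$, and let $\Delta_i=\mu^{(\star)}-\mu^{(i)}$ and $\Delta=\min_{i:\Delta_i>0}\Delta_i$. Let the policy with parameter $\epsilon$ and potential $\psi$ be as described in the context. (a) If $\epsilon\in(0,1\wedge\Delta]$, the policy with parameter $\epsilon$ and potential $\psi(x)=x^2$ satisfies, for all $n\ge1$, $$R_n\le\sum_{i:\Delta_i>0}\Big\{\Delta_i+\frac{32}{\Delta_i}\log\Big(\frac5\epsilon\Big)\Big\}.$$ (b) If $\epsilon=0$, let $v=\mathbb{E}\big[(Y^{(\star)}_1)^2\big]$, where $\star$ is an optimal arm. Then the policy with parameter $\epsilon=0$ and potential $\psi(x)=x^2$ satisfies, for all $n\ge1$, $$R_n\le\sum_{i:\Delta_i>0}\Big\{\Delta_i+(1\vee v)\frac{4\log(9n)}{\Delta_i}\Big\}.$$ (c) If $\epsilon\in(0,1\wedge\Delta]$, the policy with parameter $\epsilon$ and potential $\psi(x)=\frac{x^2}{\log(4x/\epsilon)}$ satisfies, for all $n\ge1$, $$R_n\le\sum_{i:\Delta_i>0}\Big\{\Delta_i+\frac{32\log\big(\frac{2\Delta_i}{\epsilon}\big)}{\Delta_i}\Big[3+\log\log\Big(\frac4\epsilon\Big)\Big]\Big\}.$$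
   Context: Stochastic bandit: there are $K$ arms; successive pulls of arm $i\in\{1,\dots,K\}$ yield i.i.d. rewards $Y^{(i)}_1,Y^{(i)}_2,\dots$ with distribution $\nu_i$ and mean $\mu^{(i)}$, independently across arms. A distribution $\nu_i$ with mean $\mu^{(i)}$ is called sub-Gaussian here if $\int e^{\lambda(x-\mu^{(i)})}\nu_i(dx)\le e^{\lambda^2/2}$ for all $\lambda\in\mathbb{R}$. A (possibly randomized) policy is a sequence of random variables $I_t\in\{1,\dots,K\}$ (the arm pulled at time $t$), where $I_t$ depends only on observations strictly anterior to $t$ (and on the policy's own randomization). An optimal arm $\star$ is any arm with $\mu^{(\star)}=\max_i\mu^{(i)}$. The regret at time $n$ is $R_n=n\mu^{(\star)}-\sum_{t=1}^n\mathbb{E}\,\mu^{(I_t)}=\sum_{i=1}^K\Delta_i\,\mathbb{E}\,T_i(n+1)$, where $T_i(t)=\sum_{\ell=1}^{t-1}\mathbf{1}\{I_\ell=i\}$ is the number of pulls of arm $i$ strictly before time $t$. For $s\ge1$, $\widehat\mu^{(i)}_s=\frac1s\sum_{\ell=1}^sY^{(i)}_\ell$ is the empirical mean of arm $i$ after $s$ pulls. Notation: $a\wedge b=\min(a,b)$, $a\vee b=\max(a,b)$. The policy with parameter $\epsilon\ge0$ and potential $\psi$ (it uses the knowledge that $\mu^{(\star)}=0$): (0) For $t\in\{1,\dots,K\}$, set $I_t=t$. For each $t\ge K+1$: (1) if there exists $i$ such that $\widehat\mu^{(i)}_{T_i(t)}\ge-\epsilon/2$, select $I_t\in\arg\max_{1\le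 i\le K}\widehat\mu^{(i)}_{T_i(t)}$; (2) otherwise draw $I_t$ at random, conditionally on the past, with $I_t=i$ having probability $$p_{i,t}=\frac{1/\psi(|\widehat\mu^{(i)}_{T_i(t)}|)}{\sum_{j=1}^K1/\psi(|\widehat\mu^{(j)}_{T_j(t)}|)}.$$ *)

theory Defs
  imports "HOL-Probability.Probability"
begin

text \<open>Arms are numbered \<open>1, \<dots>, K\<close>. The random variable \<open>Y i s\<close> with \<open>s \<ge> 1\<close> is the reward of
  the \<open>s\<close>-th pull of arm \<open>i\<close>; the values \<open>Y i 0\<close> are never used.\<close>

definition mean :: "real measure \<Rightarrow> real" where
  "mean \<nu> = (\<integral>x. x \<partial>\<nu>)"

text \<open>The integrability conditions rule out that an integral is \<open>0\<close> by convention.\<close>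

definition sub_gaussian :: "real measure \<Rightarrow> bool" where
  "sub_gaussian \<nu> \<longleftrightarrow> integrable \<nu> (\<lambda>x. x) \<and>
     (\<forall>l::real. integrable \<nu> (\<lambda>x. exp (l * (x - mean \<nu>))) \<and>
        (\<integral>x. exp (l * (x - mean \<nu>)) \<partial>\<nu>) \<le> exp (l\<^sup>2 / 2))"

definition opt_mean :: "nat \<Rightarrow> (nat \<Rightarrow> real measure) \<Rightarrow> real" where
  "opt_mean K \<nu> = Max ((\<lambda>i. mean (\<nu> i)) ` {1..K})"

definition gap :: "nat \<Rightarrow> (nat \<Rightarrow> real measure) \<Rightarrow> nat \<Rightarrow> real" where
  "gap K \<nu> i = opt_mean K \<nu> - mean (\<nu> i)"

definition suboptimal_arms :: "nat \<Rightarrow> (nat \<Rightarrow> real measure) \<Rightarrow> nat set" where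
  "suboptimal_arms K \<nu> = {i \<in> {1..K}. gap K \<nu> i > 0}"

text \<open>The smallest positive gap. Extended reals are used so that it is \<open>\<infinity>\<close> when all arms are
  optimal; otherwise it is the minimum of a nonempty finite set of reals.\<close>

definition min_gap :: "nat \<Rightarrow> (nat \<Rightarrow> real measure) \<Rightarrow> ereal" where
  "min_gap K \<nu> = (INF i \<in> suboptimal_arms K \<nu>. ereal (gap K \<nu> i))"

locale stochastic_bandit = prob_space M for M :: "'a measure" +
  fixes K :: nat
    and \<nu> :: "nat \<Rightarrow> real measure"
    and Y :: "nat \<Rightarrow> nat \<Rightarrow> 'a \<Rightarrow> real"
  assumes K_pos: "K \<ge> 1"
    and nu_prob: "i \<in> {1..K} \<Longrightarrow> prob_space (\<nu> i)"
    and nu_sets: "i \<in> {1..K} \<Longrightarrow> sets (\<nu> i) = sets borel"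
    and rewards_distr: "i \<in> {1..K} \<Longrightarrow> s \<ge> 1 \<Longrightarrow> distr M borel (Y i s) = \<nu> i"
    and rewards_indep: "indep_vars (\<lambda>_. borel) (\<lambda>(i, s). Y i s) ({1..K} \<times> {1..})"

text \<open>\<open>I t\<close> is the arm pulled at time \<open>t \<ge> 1\<close>.\<close>

definition pulls :: "(nat \<Rightarrow> 'a \<Rightarrow> nat) \<Rightarrow> nat \<Rightarrow> nat \<Rightarrow> 'a \<Rightarrow> nat" where
  "pulls I i t \<omega> = card {l \<in> {1..<t}. I l \<omega> = i}"

definition emp_mean :: "(nat \<Rightarrow> nat \<Rightarrow> 'a \<Rightarrow> real) \<Rightarrow> nat \<Rightarrow> nat \<Rightarrow> 'a \<Rightarrow> real" where
  "emp_mean Y i s \<omega> = (1 / real s) * (\<Sum>l = 1..s. Y i l \<omega>)"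

definition cur_mean ::
  "(nat \<Rightarrow> nat \<Rightarrow> 'a \<Rightarrow> real) \<Rightarrow> (nat \<Rightarrow> 'a \<Rightarrow> nat) \<Rightarrow> nat \<Rightarrow> nat \<Rightarrow> 'a \<Rightarrow> real" where
  "cur_mean Y I i t \<omega> = emp_mean Y i (pulls I i t \<omega>) \<omega>"

text \<open>The reward collected at time \<open>t\<close> is the next unused one of the arm pulled at that time.\<close>

definition observed ::
  "(nat \<Rightarrow> nat \<Rightarrow> 'a \<Rightarrow> real) \<Rightarrow> (nat \<Rightarrow> 'a \<Rightarrow> nat) \<Rightarrow> nat \<Rightarrow> 'a \<Rightarrow> real" where
  "observed Y I t \<omega> = Y (I t \<omega>) (Suc (pulls I (I t \<omega>) t \<omega>)) \<omega>"

text \<open>The observations strictly anterior to \<open>t\<close>, and the \<open>\<sigma>\<close>-algebra they generate.\<close>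

definition history ::
  "(nat \<Rightarrow> nat \<Rightarrow> 'a \<Rightarrow> real) \<Rightarrow> (nat \<Rightarrow> 'a \<Rightarrow> nat) \<Rightarrow> nat \<Rightarrow> 'a \<Rightarrow> nat \<Rightarrow> nat \<times> real" where
  "history Y I t \<omega> = (\<lambda>l\<in>{1..<t}. (I l \<omega>, observed Y I l \<omega>))"

definition history_space :: "nat \<Rightarrow> (nat \<Rightarrow> nat \<times> real) measure" where
  "history_space t = (\<Pi>\<^sub>M l\<in>{1..<t}. count_space UNIV \<Otimes>\<^sub>M borel)"

definition past ::
  "'a measure \<Rightarrow> (nat \<Rightarrow> nat \<Rightarrow> 'a \<Rightarrow> real) \<Rightarrow> (nat \<Rightarrow> 'a \<Rightarrow> nat) \<Rightarrow> nat \<Rightarrow> 'a measure" where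
  "past M Y I t = vimage_algebra (space M) (history Y I t) (history_space t)"

text \<open>\<open>U\<close> is the policy's own randomization, an arbitrary random element independent of all
  rewards (including those that are never observed). It stands for the randomization at all times
  and may for instance be a sequence.\<close>

locale randomized_policy = stochastic_bandit M K \<nu> Y
  for M :: "'a measure" and K \<nu> Y +
  fixes N :: "'u measure"
    and U :: "'a \<Rightarrow> 'u"
    and I :: "nat \<Rightarrow> 'a \<Rightarrow> nat"
  assumes U_measurable: "U \<in> measurable M N"
    and U_indep: "indep_set (sets (vimage_algebra (space M) U N))
        (sets (vimage_algebra (space M) (\<lambda>\<omega>. \<lambda>p\<in>{1..K} \<times> {1..}. Y (fst p) (snd p) \<omega>)
          (\<Pi>\<^sub>M p\<in>{1..K} \<times> {1..}. borel)))"
    and I_measurable: "t \<ge> 1 \<Longrightarrow> I t \<in> measurable M (count_space {1..K})"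
    and I_nonanticipating: "t \<ge> 1 \<Longrightarrow>
        \<exists>\<phi> \<in> measurable (N \<Otimes>\<^sub>M history_space t) (count_space {1..K}).
          \<forall>\<omega> \<in> space M. I t \<omega> = \<phi> (U \<omega>, history Y I t \<omega>)"

text \<open>Ties in the greedy step may be broken in any way, possibly at random. In the exploration step
  all current empirical means are negative.\<close>

locale potential_policy = randomized_policy M K \<nu> Y N U I
  for M :: "'a measure" and K \<nu> Y and N :: "'u measure" and U I +
  fixes \<epsilon> :: real
    and \<psi> :: "real \<Rightarrow> real"
  assumes eps_nonneg: "\<epsilon> \<ge> 0"
    and initial: "t \<in> {1..K} \<Longrightarrow> \<omega> \<in> space M \<Longrightarrow> I t \<omega> = t"
    and greedy: "t \<ge> K + 1 \<Longrightarrow> \<omega> \<in> space M \<Longrightarrow>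
        \<exists>i \<in> {1..K}. cur_mean Y I i t \<omega> \<ge> - \<epsilon> / 2 \<Longrightarrow>
        is_arg_max (\<lambda>i. cur_mean Y I i t \<omega>) (\<lambda>i. i \<in> {1..K}) (I t \<omega>)"
    and explore: "t \<ge> K + 1 \<Longrightarrow> i \<in> {1..K} \<Longrightarrow>
        AE \<omega> in M. \<not> (\<exists>j \<in> {1..K}. cur_mean Y I j t \<omega> \<ge> - \<epsilon> / 2) \<longrightarrow>
          real_cond_exp M (past M Y I t) (indicator {\<omega> \<in> space M. I t \<omega> = i}) \<omega> =
            (1 / \<psi> \<bar>cur_mean Y I i t \<omega>\<bar>) / (\<Sum>j = 1..K. 1 / \<psi> \<bar>cur_mean Y I j t \<omega>\<bar>)"

definition regret ::
  "'a measure \<Rightarrow> nat \<Rightarrow> (nat \<Rightarrow> real measure) \<Rightarrow> (nat \<Rightarrow> 'a \<Rightarrow> nat) \<Rightarrow> nat \<Rightarrow> real" where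
  "regret M K \<nu> I n = real n * opt_mean K \<nu> - (\<Sum>t = 1..n. \<integral>\<omega>. mean (\<nu> (I t \<omega>)) \<partial>M)"

end

(*
  Let X_i, X_j be the current empirical means of a suboptimal arm i with gap D and of an optimal
  arm j. A pull of i while X_i >= - D / 2 is paid for by the Gaussian upper tail of the empirical
  means of i, summed over their sample sizes. While X_i < - D / 2, arm i can only be pulled in the
  randomized step. There the probabilities of pulling i and j have ratio psi|X_j| / psi|X_i|, which
  is at most psi|X_j| / psi(D / 2), so the expected number of such pulls is at most 1 / psi(D / 2)
  times the sum over s of E[psi|X|; X < - eps / 2], where X is the mean of the first s rewards of j.
  For eps > 0 this sum is bounded by the layer-cake formula, with
  sum_s P(X <= - y) <= 1 / (exp(y^2 / 2) - 1); for eps = 0 by the second moments v / s.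
*)
theory Submission
  imports Defs "HOL-Real_Asymp.Real_Asymp"
begin

text \<open>The obstacle is that the sample size behind a current mean is random and depends on the
  rewards, so tail bounds for a fixed sample size do not apply to it directly. Sums over times are
  therefore kept together with an indicator that a fixed arm is pulled: along those times the counts
  of that arm are distinct, so the sum is bounded pointwise by a sum over deterministic sample
  sizes. This is why pulls of the bad arm are exchanged for pulls of an optimal arm: the factor in
  X_j then carries the indicator of pulling j, and can be reindexed by the samples of j. The
  threshold - D / 2 is halfway between the means - D and 0, and eps <= D places it below - eps / 2.
  A greedy choice of i would need X_i >= - eps / 2. As the truncation level tends to 0, the
  layer-cake bound for the square potential diverges logarithmically. For eps = 0 the second moments
  replace it, and their harmonic sum brings in the horizon. The constant 9 there is too tight for a
  single threshold, so the count of pulls is bounded with a general weight \<open>w\<close> with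
  values in [0, 1].\<close>

section \<open>Layer-cake bounds for Gaussian tails\<close>

text \<open>A geometric series, and \<open>exp z >= 1 + z\<close>. Both forms matter: the first
  decays at infinity and, multiplied by \<open>y\<close>, has an elementary primitive, whereas
  \<open>y\<close> times \<open>2 / y\<^sup>2\<close> is not integrable at infinity.\<close>

lemma sum_gauss_tail_le:
  assumes y: "y > 0"
  shows "(\<Sum>s = 1..m. exp (- (y\<^sup>2 / 2)) ^ s) \<le> 1 / (exp (y\<^sup>2 / 2) - 1 :: real)"
    and "1 / (exp (y\<^sup>2 / 2) - 1 :: real) \<le> 2 / y\<^sup>2"
proof -
  define q where "q = exp (- (y\<^sup>2 / 2))"
  have q: "0 < q" "q < 1" using y by (auto simp: q_def)
  have "(\<Sum>s = 1..m. q ^ s) = q * (\<Sum>s<m. q ^ s)"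
    by (simp add: sum_distrib_left sum.atLeast1_atMost_eq)
  also have "\<dots> = q * ((1 - q ^ m) / (1 - q))" using q by (simp add: sum_gp_strict)
  also have "\<dots> \<le> q * (1 / (1 - q))" using q by (intro mult_left_mono divide_right_mono) auto
  also have "\<dots> = 1 / (exp (y\<^sup>2 / 2) - 1)" using q by (simp add: q_def exp_minus field_simps)
  finally show "(\<Sum>s = 1..m. exp (- (y\<^sup>2 / 2)) ^ s) \<le> 1 / (exp (y\<^sup>2 / 2) - 1)" by (simp add: q_def)
  show "1 / (exp (y\<^sup>2 / 2) - 1) \<le> 2 / y\<^sup>2"
    using y exp_ge_add_one_self[of "y\<^sup>2 / 2"] by (simp add: field_simps)
qed

text \<open>On \<open>X > a\<close>, \<open>h X\<close> is \<open>h a\<close> plus the integral of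
  \<open>h'\<close> from \<open>a\<close> to \<open>X\<close>; Tonelli then exchanges the integrals
  over \<open>\<omega>\<close> and over the level \<open>y\<close>.\<close>

lemma (in sigma_finite_measure) nn_integral_layer_cake_le:
  fixes h h' :: "real \<Rightarrow> real"
  assumes X [measurable]: "X \<in> borel_measurable M" and h' [measurable]: "h' \<in> borel_measurable borel"
    and deriv: "\<And>x. x \<ge> a \<Longrightarrow> (h has_real_derivative h' x) (at x)"
    and pos: "\<And>x. x \<ge> a \<Longrightarrow> h' x \<ge> 0" "h a \<ge> 0"
  shows "(\<integral>\<^sup>+\<omega>. ennreal (h (X \<omega>)) * indicator {a<..} (X \<omega>) \<partial>M) \<le>
    ennreal (h a) * emeasure M {\<omega> \<in> space M. X \<omega> \<ge> a} +
    (\<integral>\<^sup>+y. ennreal (h' y) * emeasure M {\<omega> \<in> space M. X \<omega> \<ge> y} * indicator {a..} y \<partial>lborel)"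
proof -
  interpret pair_sigma_finite M lborel
    by (intro pair_sigma_finite.intro sigma_finite_measure_axioms lborel.sigma_finite_measure_axioms)
  let ?f = "\<lambda>\<omega> y. ennreal (h' y) * indicator {a..} y * indicator {\<omega> \<in> space M. X \<omega> \<ge> y} \<omega>"
  have meas [measurable]: "case_prod ?f \<in> borel_measurable (M \<Otimes>\<^sub>M lborel)"
  proof -
    \<comment> \<open>The indicator of a set that varies with \<open>y\<close> becomes a predicate
      on pairs, whose measurability is automatic.\<close>
    have "case_prod ?f = (\<lambda>p. ennreal (h' (snd p)) * indicator {a..} (snd p) *
        (if X (fst p) \<ge> snd p \<and> fst p \<in> space M then 1 else 0))"
      by (auto simp: fun_eq_iff indicator_def)
    also have "\<dots> \<in> borel_measurable (M \<Otimes>\<^sub>M lborel)" by measurable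
    finally show ?thesis .
  qed
  have "ennreal (h (X \<omega>)) * indicator {a<..} (X \<omega>) \<le>
      ennreal (h a) * indicator {\<omega> \<in> space M. X \<omega> \<ge> a} \<omega> + (\<integral>\<^sup>+y. ?f \<omega> y \<partial>lborel)"
    if \<omega>: "\<omega> \<in> space M" for \<omega>
  proof (cases "X \<omega> > a")
    case True
    have "(\<integral>\<^sup>+y. ?f \<omega> y \<partial>lborel) = (\<integral>\<^sup>+y. ennreal (h' y) * indicator {a..X \<omega>} y \<partial>lborel)"
      using \<omega> by (intro nn_integral_cong) (auto simp: indicator_def)
    also have "\<dots> = h (X \<omega>) - h a"
      using True deriv pos
      by (intro nn_integral_FTC_Icc) (auto intro: has_field_derivative_at_within)
    finally have eq: "(\<integral>\<^sup>+y. ?f \<omega> y \<partial>lborel) = ennreal (h (X \<omega>) - h a)" .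
    have "h a \<le> h (X \<omega>)"
      using True deriv pos by (intro DERIV_nonneg_imp_nondecreasing[of a "X \<omega>" h]) auto
    then show ?thesis
      unfolding eq using True \<omega> pos(2) by (simp flip: ennreal_plus)
  qed simp
  then have "(\<integral>\<^sup>+\<omega>. ennreal (h (X \<omega>)) * indicator {a<..} (X \<omega>) \<partial>M) \<le>
      (\<integral>\<^sup>+\<omega>. ennreal (h a) * indicator {\<omega> \<in> space M. X \<omega> \<ge> a} \<omega> + (\<integral>\<^sup>+y. ?f \<omega> y \<partial>lborel) \<partial>M)"
    by (rule nn_integral_mono)
  also have "\<dots> = ennreal (h a) * emeasure M {\<omega> \<in> space M. X \<omega> \<ge> a} +
      (\<integral>\<^sup>+\<omega>. (\<integral>\<^sup>+y. ?f \<omega> y \<partial>lborel) \<partial>M)"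
    by (subst nn_integral_add) (auto simp: nn_integral_cmult)
  also have "(\<integral>\<^sup>+\<omega>. (\<integral>\<^sup>+y. ?f \<omega> y \<partial>lborel) \<partial>M) = (\<integral>\<^sup>+y. (\<integral>\<^sup>+\<omega>. ?f \<omega> y \<partial>M) \<partial>lborel)"
    by (rule Fubini'[OF meas, symmetric])
  also have "\<dots> = (\<integral>\<^sup>+y. ennreal (h' y) * emeasure M {\<omega> \<in> space M. X \<omega> \<ge> y} * indicator {a..} y \<partial>lborel)"
    by (intro nn_integral_cong) (simp add: nn_integral_cmult mult_ac)
  finally show ?thesis .
qed

text \<open>The sum over \<open>s\<close> is moved inside the integral over the level
  \<open>y\<close> before estimating, so that each level contributes a geometric series. Only the
  boundary term at \<open>a\<close> uses the cruder bound \<open>2 / a\<^sup>2\<close>.\<close>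

lemma (in prob_space) sum_nn_integral_gauss_tail_le:
  fixes h h' :: "real \<Rightarrow> real" and X :: "nat \<Rightarrow> 'a \<Rightarrow> real"
  assumes X [measurable]: "\<And>s. s \<in> {1..m} \<Longrightarrow> X s \<in> borel_measurable M"
    and tail: "\<And>s y. s \<in> {1..m} \<Longrightarrow> y \<ge> a \<Longrightarrow>
      prob {\<omega> \<in> space M. X s \<omega> \<ge> y} \<le> exp (- (y\<^sup>2 / 2)) ^ s"
    and a: "a > 0" and h' [measurable]: "h' \<in> borel_measurable borel"
    and deriv: "\<And>x. x \<ge> a \<Longrightarrow> (h has_real_derivative h' x) (at x)"
    and pos: "\<And>x. x \<ge> a \<Longrightarrow> h' x \<ge> 0" "h a \<ge> 0"
  shows "(\<Sum>s = 1..m. \<integral>\<^sup>+\<omega>. ennreal (h (X s \<omega>)) * indicator {a<..} (X s \<omega>) \<partial>M) \<le>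
    ennreal (h a * (2 / a\<^sup>2)) +
    (\<integral>\<^sup>+y. ennreal (h' y / (exp (y\<^sup>2 / 2) - 1)) * indicator {a..} y \<partial>lborel)"
proof -
  have sum_le: "(\<Sum>s = 1..m. emeasure M {\<omega> \<in> space M. X s \<omega> \<ge> y}) \<le> ennreal (1 / (exp (y\<^sup>2 / 2) - 1))"
    if "y \<ge> a" for y
  proof -
    have "(\<Sum>s = 1..m. emeasure M {\<omega> \<in> space M. X s \<omega> \<ge> y}) =
        ennreal (\<Sum>s = 1..m. prob {\<omega> \<in> space M. X s \<omega> \<ge> y})"
      by (simp add: emeasure_eq_measure)
    also have "\<dots> \<le> ennreal (1 / (exp (y\<^sup>2 / 2) - 1))"
    proof (rule ennreal_leI)
      have "(\<Sum>s = 1..m. prob {\<omega> \<in> space M. X s \<omega> \<ge> y}) \<le> (\<Sum>s = 1..m. exp (- (y\<^sup>2 / 2)) ^ s)"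
        using tail that by (intro sum_mono) auto
      also have "\<dots> \<le> 1 / (exp (y\<^sup>2 / 2) - 1)"
        using that a by (intro sum_gauss_tail_le(1)) simp
      finally show "(\<Sum>s = 1..m. prob {\<omega> \<in> space M. X s \<omega> \<ge> y}) \<le> 1 / (exp (y\<^sup>2 / 2) - 1)" .
    qed
    finally show ?thesis .
  qed
  have "(\<Sum>s = 1..m. \<integral>\<^sup>+\<omega>. ennreal (h (X s \<omega>)) * indicator {a<..} (X s \<omega>) \<partial>M) \<le>
      (\<Sum>s = 1..m. ennreal (h a) * emeasure M {\<omega> \<in> space M. X s \<omega> \<ge> a} +
        (\<integral>\<^sup>+y. ennreal (h' y) * emeasure M {\<omega> \<in> space M. X s \<omega> \<ge> y} * indicator {a..} y \<partial>lborel))"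
    by (rule sum_mono, rule nn_integral_layer_cake_le[OF X h' deriv pos])
  also have "\<dots> = ennreal (h a) * (\<Sum>s = 1..m. emeasure M {\<omega> \<in> space M. X s \<omega> \<ge> a}) +
      (\<integral>\<^sup>+y. (\<Sum>s = 1..m. ennreal (h' y) * emeasure M {\<omega> \<in> space M. X s \<omega> \<ge> y} * indicator {a..} y) \<partial>lborel)"
  proof -
    have "(\<lambda>y. emeasure M {\<omega> \<in> space M. X s \<omega> \<ge> y}) \<in> borel_measurable lborel" if [simp]: "s \<in> {1..m}" for s
    proof -
      \<comment> \<open>A tail probability is antitone in \<open>y\<close>, hence Borel; the sign is
        flipped to apply the rule for monotone functions.\<close>
      have "mono (\<lambda>y. - prob {\<omega> \<in> space M. X s \<omega> \<ge> y})"
        using X[OF that] by (intro monoI) (auto intro!: finite_measure_mono)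
      then have "(\<lambda>y. - prob {\<omega> \<in> space M. X s \<omega> \<ge> y}) \<in> borel_measurable borel"
        by (rule borel_measurable_mono)
      then have "(\<lambda>y. - (- prob {\<omega> \<in> space M. X s \<omega> \<ge> y})) \<in> borel_measurable borel" by measurable
      then show ?thesis by (simp add: emeasure_eq_measure)
    qed
    then show ?thesis
      by (subst nn_integral_sum) (auto simp: sum.distrib sum_distrib_left)
  qed
  also have "\<dots> \<le> ennreal (h a) * ennreal (2 / a\<^sup>2) +
      (\<integral>\<^sup>+y. ennreal (h' y / (exp (y\<^sup>2 / 2) - 1)) * indicator {a..} y \<partial>lborel)"
  proof (intro add_mono mult_left_mono nn_integral_mono)
    show "(\<Sum>s = 1..m. emeasure M {\<omega> \<in> space M. X s \<omega> \<ge> a}) \<le> ennreal (2 / a\<^sup>2)"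
      using sum_le[of a] sum_gauss_tail_le(2)[OF a] by (auto intro: order_trans ennreal_leI)
    fix y
    show "(\<Sum>s = 1..m. ennreal (h' y) * emeasure M {\<omega> \<in> space M. X s \<omega> \<ge> y} * indicator {a..} y) \<le>
        ennreal (h' y / (exp (y\<^sup>2 / 2) - 1)) * indicator {a..} y"
    proof (cases "y \<ge> a")
      case True
      then have "(\<Sum>s = 1..m. ennreal (h' y) * emeasure M {\<omega> \<in> space M. X s \<omega> \<ge> y} * indicator {a..} y) =
          ennreal (h' y) * (\<Sum>s = 1..m. emeasure M {\<omega> \<in> space M. X s \<omega> \<ge> y})"
        by (simp add: sum_distrib_left)
      also have "\<dots> \<le> ennreal (h' y) * ennreal (1 / (exp (y\<^sup>2 / 2) - 1))"
        using sum_le[OF True] by (intro mult_left_mono) auto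
      also have "\<dots> = ennreal (h' y / (exp (y\<^sup>2 / 2) - 1))"
        using pos(1)[OF True] by (simp flip: ennreal_mult)
      finally show ?thesis using True by simp
    qed simp
  qed simp
  also have "ennreal (h a) * ennreal (2 / a\<^sup>2) = ennreal (h a * (2 / a\<^sup>2))"
    using pos(2) by (simp flip: ennreal_mult)
  finally show ?thesis .
qed

text \<open>The primitive \<open>2 * ln (1 - exp (- (y\<^sup>2 / 2)))\<close> vanishes at infinity.
  This is the case \<open>h' y = 2 * y\<close>, that of the square potential. The estimate is
  \<open>exp (- x) <= 1 / (1 + x)\<close> at \<open>x = a\<^sup>2 / 2\<close>.\<close>

lemma nn_integral_linear_gauss_sum:
  assumes a: "a > 0"
  shows "(\<integral>\<^sup>+y. ennreal (2 * y / (exp (y\<^sup>2 / 2) - 1)) * indicator {a..} y \<partial>lborel) =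
      ennreal (- 2 * ln (1 - exp (- (a\<^sup>2 / 2))))"
    and "- 2 * ln (1 - exp (- (a\<^sup>2 / 2))) \<le> 2 * ln (1 + 2 / a\<^sup>2)"
proof -
  have "(\<integral>\<^sup>+y. ennreal (2 * y / (exp (y\<^sup>2 / 2) - 1)) * indicator {a..} y \<partial>lborel) =
      0 - 2 * ln (1 - exp (- (a\<^sup>2 / 2)))"
  proof (rule nn_integral_FTC_atLeast)
    fix y assume "a \<le> y"
    then have y: "y > 0" using a by simp
    then have "exp (- (y\<^sup>2 / 2)) < 1" by simp
    then show "((\<lambda>y. 2 * ln (1 - exp (- (y\<^sup>2 / 2)))) has_real_derivative 2 * y / (exp (y\<^sup>2 / 2) - 1)) (at y)"
      using y by (auto intro!: derivative_eq_intros simp: exp_minus field_simps)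
    show "0 \<le> 2 * y / (exp (y\<^sup>2 / 2) - 1)" using y by simp
  next
    show "((\<lambda>y::real. 2 * ln (1 - exp (- (y\<^sup>2 / 2)))) \<longlongrightarrow> 0) at_top" by real_asymp
  qed measurable
  then show "(\<integral>\<^sup>+y. ennreal (2 * y / (exp (y\<^sup>2 / 2) - 1)) * indicator {a..} y \<partial>lborel) =
      ennreal (- 2 * ln (1 - exp (- (a\<^sup>2 / 2))))" by simp
  have x: "0 < a\<^sup>2 / 2" using a by simp
  have "1 / (1 + 2 / a\<^sup>2) \<le> 1 - exp (- (a\<^sup>2 / 2))"
  proof -
    have "exp (- (a\<^sup>2 / 2)) \<le> 1 / (1 + a\<^sup>2 / 2)"
      using x exp_ge_add_one_self[of "a\<^sup>2 / 2"] unfolding exp_minus inverse_eq_divide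
      by (intro divide_left_mono mult_pos_pos add_pos_pos) auto
    moreover have "1 / (1 + 2 / a\<^sup>2) = 1 - 1 / (1 + a\<^sup>2 / 2)"
      using a add_nonneg_pos[of "a\<^sup>2" 2] by (simp add: divide_simps)
    ultimately show ?thesis by simp
  qed
  moreover have p: "0 < 1 + 2 / a\<^sup>2" using a by (simp add: add_pos_pos)
  ultimately have "ln (1 / (1 + 2 / a\<^sup>2)) \<le> ln (1 - exp (- (a\<^sup>2 / 2)))"
    using x by (subst ln_le_cancel_iff) auto
  then show "- 2 * ln (1 - exp (- (a\<^sup>2 / 2))) \<le> 2 * ln (1 + 2 / a\<^sup>2)"
    using p by (simp add: ln_div)
qed

text \<open>With \<open>L = ln (4 * x / \<epsilon>)\<close> the derivative is
  \<open>(x / L) * (2 - 1 / L)\<close>, nonnegative once \<open>L >= 1 / 2\<close>. The factor 4 in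
  the potential ensures this from the threshold on, since \<open>L = ln 2\<close> at
  \<open>x = \<epsilon> / 2\<close>.\<close>

lemma has_real_derivative_square_over_ln:
  assumes "0 < \<epsilon>" "\<epsilon> / 2 \<le> x"
  shows "((\<lambda>x. x\<^sup>2 / ln (4 * x / \<epsilon>)) has_real_derivative
      2 * x / ln (4 * x / \<epsilon>) - x / (ln (4 * x / \<epsilon>))\<^sup>2) (at x)"
    and "2 / 3 \<le> ln (4 * x / \<epsilon>)"
    and "0 \<le> 2 * x / ln (4 * x / \<epsilon>) - x / (ln (4 * x / \<epsilon>))\<^sup>2"
proof -
  have x: "x > 0" "2 \<le> 4 * x / \<epsilon>" using assms by (auto simp: field_simps)
  then have "ln 2 \<le> ln (4 * x / \<epsilon>)" by (subst ln_le_cancel_iff) auto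
  then show L: "2 / 3 \<le> ln (4 * x / \<epsilon>)" using ln2_ge_two_thirds by linarith
  show "((\<lambda>x. x\<^sup>2 / ln (4 * x / \<epsilon>)) has_real_derivative
      2 * x / ln (4 * x / \<epsilon>) - x / (ln (4 * x / \<epsilon>))\<^sup>2) (at x)"
    using x L assms
    by (auto intro!: derivative_eq_intros simp: field_simps power2_eq_square)
  have "x / (ln (4 * x / \<epsilon>))\<^sup>2 = x / ln (4 * x / \<epsilon>) * (1 / ln (4 * x / \<epsilon>))"
    by (simp add: power2_eq_square)
  also have "\<dots> \<le> x / ln (4 * x / \<epsilon>) * 2"
    using x L by (intro mult_left_mono) (auto simp: field_simps)
  finally show "0 \<le> 2 * x / ln (4 * x / \<epsilon>) - x / (ln (4 * x / \<epsilon>))\<^sup>2" by (simp add: mult.commute)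
qed

text \<open>Split at \<open>y = 1\<close>, with \<open>L = ln (4 * y / \<epsilon>)\<close>. Below 1,
  the bound \<open>2 / y\<^sup>2\<close> leaves \<open>4 / (y * L)\<close>, whose primitive
  \<open>4 * ln L\<close> is the origin of the iterated logarithm. Above 1,
  \<open>L >= ln (4 / \<epsilon>) >= 1\<close> reduces to the integral without logarithm.\<close>

lemma nn_integral_square_over_ln_le:
  assumes eps: "0 < \<epsilon>" "\<epsilon> \<le> 1"
  shows "(\<integral>\<^sup>+y. ennreal ((2 * y / ln (4 * y / \<epsilon>) - y / (ln (4 * y / \<epsilon>))\<^sup>2) / (exp (y\<^sup>2 / 2) - 1)) *
      indicator {\<epsilon> / 2..} y \<partial>lborel) \<le> ennreal (6 + 4 * ln (ln (4 / \<epsilon>)))"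
proof -
  let ?L = "\<lambda>y. ln (4 * y / \<epsilon>)"
  have L4: "ln (4 / \<epsilon>) \<ge> 1"
  proof -
    have "exp 1 \<le> 4 / \<epsilon>" using mult_mono[of \<epsilon> 1 "exp 1" 3] exp_le eps by (simp add: field_simps)
    then show ?thesis using eps by (subst ln_ge_iff) auto
  qed
  have pt: "ennreal ((2 * y / ?L y - y / (?L y)\<^sup>2) / (exp (y\<^sup>2 / 2) - 1)) * indicator {\<epsilon> / 2..} y \<le>
      ennreal (4 / (y * ?L y)) * indicator {\<epsilon> / 2..1} y +
      ennreal (2 * y / (exp (y\<^sup>2 / 2) - 1)) * indicator {1..} y" for y
  proof (cases "\<epsilon> / 2 \<le> y")
    case True
    then have y: "y > 0" using eps by simp
    note L = has_real_derivative_square_over_ln(2,3)[OF eps(1) True]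
    have D: "exp (y\<^sup>2 / 2) - 1 > 0" using y by simp
    have le: "(2 * y / ?L y - y / (?L y)\<^sup>2) / (exp (y\<^sup>2 / 2) - 1) \<le> 2 * y / ?L y * (1 / (exp (y\<^sup>2 / 2) - 1))"
    proof -
      have "0 \<le> y / (?L y)\<^sup>2 / (exp (y\<^sup>2 / 2) - 1)" using D y by simp
      then show ?thesis by (simp only: diff_divide_distrib mult_1_right times_divide_eq_right)
    qed
    show ?thesis
    proof (cases "y \<le> 1")
      case y1: True
      have "2 * y / ?L y * (1 / (exp (y\<^sup>2 / 2) - 1)) \<le> 2 * y / ?L y * (2 / y\<^sup>2)"
        using sum_gauss_tail_le(2)[OF y] y L by (intro mult_left_mono) auto
      also have "\<dots> = 4 / (y * ?L y)" using y by (simp add: power2_eq_square)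
      finally have "ennreal ((2 * y / ?L y - y / (?L y)\<^sup>2) / (exp (y\<^sup>2 / 2) - 1)) \<le> ennreal (4 / (y * ?L y))"
        using le by (intro ennreal_leI) linarith
      then show ?thesis using True y1 by (simp add: add_increasing2)
    next
      case False
      have "ln (4 / \<epsilon>) \<le> ?L y" using False eps by (subst ln_le_cancel_iff) (auto simp: field_simps)
      then have "2 * y / ?L y * (1 / (exp (y\<^sup>2 / 2) - 1)) \<le> 2 * y * (1 / (exp (y\<^sup>2 / 2) - 1))"
        using L4 y D by (intro mult_right_mono) (auto simp: field_simps)
      then have "ennreal ((2 * y / ?L y - y / (?L y)\<^sup>2) / (exp (y\<^sup>2 / 2) - 1)) \<le>
          ennreal (2 * y / (exp (y\<^sup>2 / 2) - 1))"
        using le by (intro ennreal_leI) simp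
      then show ?thesis using True False by simp
    qed
  qed simp
  have I1: "(\<integral>\<^sup>+y. ennreal (4 / (y * ?L y)) * indicator {\<epsilon> / 2..1} y \<partial>lborel) =
      4 * ln (?L 1) - 4 * ln (?L (\<epsilon> / 2))"
  proof (rule nn_integral_FTC_Icc[where F = "\<lambda>y. 4 * ln (?L y)"])
    fix y assume y: "y \<in> {\<epsilon> / 2..1}"
    then have y0: "y > 0" "\<epsilon> < y * 4" using eps by auto
    have L: "2 / 3 \<le> ?L y" using has_real_derivative_square_over_ln(2)[of \<epsilon> y] eps y by auto
    show "((\<lambda>y. 4 * ln (?L y)) has_real_derivative 4 / (y * ?L y)) (at y)"
      using L y0 eps by (auto intro!: derivative_eq_intros simp: field_simps)
    show "0 \<le> 4 / (y * ?L y)" using L y0 by simp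
  qed (use eps in auto)
  have "(\<integral>\<^sup>+y. ennreal ((2 * y / ?L y - y / (?L y)\<^sup>2) / (exp (y\<^sup>2 / 2) - 1)) * indicator {\<epsilon> / 2..} y \<partial>lborel) \<le>
      (\<integral>\<^sup>+y. ennreal (4 / (y * ?L y)) * indicator {\<epsilon> / 2..1} y +
        ennreal (2 * y / (exp (y\<^sup>2 / 2) - 1)) * indicator {1..} y \<partial>lborel)"
    using pt by (rule nn_integral_mono)
  also have "\<dots> = ennreal (4 * ln (?L 1) - 4 * ln (?L (\<epsilon> / 2))) + ennreal (- 2 * ln (1 - exp (- (1\<^sup>2 / 2))))"
    using I1 nn_integral_linear_gauss_sum(1)[of 1] by (subst nn_integral_add) auto
  \<comment> \<open>The 2 bounds the lower endpoint term \<open>- 4 * ln (ln 2)\<close>, and the 4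
    bounds the tail beyond 1, which is at most \<open>2 * ln 3\<close>.\<close>
  also have "\<dots> \<le> ennreal (4 * ln (ln (4 / \<epsilon>)) + 2) + ennreal 4"
  proof (intro add_mono ennreal_leI)
    have "ln (2 / 3) \<le> ln (ln 2 :: real)" using ln2_ge_two_thirds by (subst ln_le_cancel_iff) auto
    moreover have "- (1 / 2) \<le> ln (2 / 3 :: real)" using ln_le_minus_one[of "3 / 2 :: real"] by (simp add: ln_div)
    ultimately have "- (1 / 2) \<le> ln (ln 2 :: real)" by linarith
    moreover have "?L (\<epsilon> / 2) = ln 2" using eps by simp
    ultimately show "4 * ln (?L 1) - 4 * ln (?L (\<epsilon> / 2)) \<le> 4 * ln (ln (4 / \<epsilon>)) + 2"
      by (simp only: mult_1_right)
    show "- 2 * ln (1 - exp (- (1\<^sup>2 / 2))) \<le> (4::real)"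
      using nn_integral_linear_gauss_sum(2)[of 1] ln_le_minus_one[of "3 :: real"] by simp
  qed
  also have "\<dots> = ennreal (6 + 4 * ln (ln (4 / \<epsilon>)))"
    using L4 by (subst ennreal_plus[symmetric]) (auto simp: add_ac)
  finally show ?thesis .
qed

text \<open>The fraction \<open>13 / 22\<close> is an upper bound of the Euler-Mascheroni constant.
  At \<open>m = n - 1\<close> the logarithm becomes \<open>ln n\<close>, and the constant has to be
  this sharp for the final \<open>ln (9 * n)\<close>.\<close>

lemma harm_le_ln: "harm m \<le> ln (real m + 1) + (13 / 22 :: real)"
proof (cases "m = 0")
  case False
  then have "harm m - ln (real (Suc m)) + inverse (real (2 * (m + 1))) \<le> (euler_mascheroni :: real)"
    using euler_mascheroni_bounds[of m] by simp
  moreover have "0 \<le> inverse (real (2 * (m + 1)))" by simp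
  moreover have "real (Suc m) = real m + 1" by simp
  ultimately show ?thesis using euler_mascheroni_less_13_over_22 by (simp only:)
qed (simp add: harm_def)

text \<open>The precision is dictated by \<open>32 / 5 + 4 * (13 / 22) <= 8 * ln 3\<close>: the left
  side is 8.7636..., and \<open>8 * 1.0955 = 8.764\<close>.\<close>

lemma ln_3_ge: "1.0955 \<le> ln (3::real)"
  using ln_approx_bounds[of 3 3, simplified, simplified eval_nat_numeral, simplified] by simp

section \<open>Empirical means of sub-Gaussian rewards\<close>

text \<open>Independence concerns finite subfamilies, and an injection carries a finite
  \<open>J'\<close> to its image with the same intersection and the same product. It extracts the
  rewards of one arm from the doubly indexed family.\<close>

lemma (in prob_space) indep_vars_reindex_inj:
  assumes ind: "indep_vars M' X L" and f: "inj_on f J" "f ` J \<subseteq> L"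
  shows "indep_vars (\<lambda>j. M' (f j)) (\<lambda>j. X (f j)) J"
proof -
  let ?F = "\<lambda>i. {X i -` A \<inter> space M | A. A \<in> sets (M' i)}"
  have L: "indep_sets ?F L" and rv: "\<forall>i\<in>L. random_variable (M' i) (X i)"
    using ind unfolding indep_vars_def2 by auto
  have "indep_sets (\<lambda>j. ?F (f j)) J"
  proof (rule indep_setsI)
    fix j assume "j \<in> J"
    then show "?F (f j) \<subseteq> events" using rv f(2) by (auto intro: measurable_sets)
  next
    fix A J' assume J': "J' \<noteq> {}" "J' \<subseteq> J" "finite J'" and A: "\<forall>j\<in>J'. A j \<in> ?F (f j)"
    have inj: "inj_on f J'" using f(1) J'(2) inj_on_subset by blast
    define B where "B = (\<lambda>i. A (the_inv_into J' f i))"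
    have B: "B (f j) = A j" if "j \<in> J'" for j
      using the_inv_into_f_f[OF inj that] by (simp add: B_def)
    have "prob (\<Inter>i\<in>f ` J'. B i) = (\<Prod>i\<in>f ` J'. prob (B i))"
      proof (intro indep_setsD[OF L])
      show "f ` J' \<subseteq> L" using J'(2) f(2) by blast
    qed (use J' A in \<open>auto simp: B\<close>)
    then show "prob (\<Inter>j\<in>J'. A j) = (\<Prod>j\<in>J'. prob (A j))"
      using inj by (simp add: prod.reindex B cong: INF_cong prod.cong)
  qed
  then show ?thesis using rv f(2) unfolding indep_vars_def2 by auto
qed

section \<open>Concentration and second moments for one arm at a fixed sample size\<close>

context stochastic_bandit
begin

lemma Y_measurable [measurable]:
  "i \<in> {1..K} \<Longrightarrow> s \<ge> 1 \<Longrightarrow> Y i s \<in> borel_measurable M"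
  using rewards_indep unfolding indep_vars_def2 by force

lemma arm_indep: "i \<in> {1..K} \<Longrightarrow> indep_vars (\<lambda>_. borel) (Y i) {1..s}"
  using indep_vars_reindex_inj[OF rewards_indep, of "\<lambda>j. (i, j)" "{1..s}"]
  by (simp add: inj_on_def image_subset_iff)

lemma emp_mean_measurable [measurable]:
  "i \<in> {1..K} \<Longrightarrow> emp_mean Y i s \<in> borel_measurable M"
  unfolding emp_mean_def[abs_def] by (intro borel_measurable_times borel_measurable_sum) auto

lemma integrable_nu_iff:
  fixes f :: "real \<Rightarrow> real"
  assumes "i \<in> {1..K}" "s \<ge> 1" "f \<in> borel_measurable borel"
  shows "integrable (\<nu> i) f \<longleftrightarrow> integrable M (\<lambda>\<omega>. f (Y i s \<omega>))"
  using assms rewards_distr[of i s] integrable_distr_eq[of "Y i s" M borel f] by simp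

lemma integral_nu:
  fixes f :: "real \<Rightarrow> real"
  assumes "i \<in> {1..K}" "s \<ge> 1" "f \<in> borel_measurable borel"
  shows "(\<integral>x. f x \<partial>\<nu> i) = (\<integral>\<omega>. f (Y i s \<omega>) \<partial>M)"
  using assms rewards_distr[of i s] integral_distr[of "Y i s" M borel f] by simp

text \<open>The exponential factors over the independent rewards, each with parameter
  \<open>c = l / s\<close>, and \<open>s * c\<^sup>2 / 2 = l\<^sup>2 / (2 * s)\<close>.\<close>

lemma emp_mean_mgf:
  assumes i: "i \<in> {1..K}" and sg: "sub_gaussian (\<nu> i)" and s: "s \<ge> 1"
  shows "integrable M (\<lambda>\<omega>. exp (l * (emp_mean Y i s \<omega> - mean (\<nu> i))))"
    and "(\<integral>\<omega>. exp (l * (emp_mean Y i s \<omega> - mean (\<nu> i))) \<partial>M) \<le> exp (l\<^sup>2 / (2 * real s))"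
proof -
  define c where "c = l / real s"
  define Z where "Z = (\<lambda>j \<omega>. exp (c * (Y i j \<omega> - mean (\<nu> i))))"
  have eq: "exp (l * (emp_mean Y i s \<omega> - mean (\<nu> i))) = (\<Prod>j\<in>{1..s}. Z j \<omega>)" for \<omega>
  proof -
    have "l * (emp_mean Y i s \<omega> - mean (\<nu> i)) = (\<Sum>j=1..s. c * (Y i j \<omega> - mean (\<nu> i)))"
      using s by (simp add: emp_mean_def c_def sum_subtractf right_diff_distrib sum_distrib_left)
    then show ?thesis by (simp only: Z_def exp_sum finite_atLeastAtMost)
  qed
  have ind: "indep_vars (\<lambda>_. borel) Z {1..s}"
    unfolding Z_def using indep_vars_compose2[OF arm_indep[OF i, of s],
        of "\<lambda>_ y. exp (c * (y - mean (\<nu> i)))" "\<lambda>_. borel"] by simp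
  have int: "integrable M (Z j)" if "j \<in> {1..s}" for j
    using sg integrable_nu_iff[OF i, of j "\<lambda>y. exp (c * (y - mean (\<nu> i)))"] that
    by (auto simp: sub_gaussian_def Z_def)
  have le: "(\<integral>\<omega>. Z j \<omega> \<partial>M) \<le> exp (c\<^sup>2 / 2)" if "j \<in> {1..s}" for j
  proof -
    have "(\<integral>x. exp (c * (x - mean (\<nu> i))) \<partial>\<nu> i) \<le> exp (c\<^sup>2 / 2)"
      using sg unfolding sub_gaussian_def by blast
    then show ?thesis
      using integral_nu[OF i, of j "\<lambda>y. exp (c * (y - mean (\<nu> i)))"] that by (simp add: Z_def)
  qed
  show "integrable M (\<lambda>\<omega>. exp (l * (emp_mean Y i s \<omega> - mean (\<nu> i))))"
    unfolding eq by (rule indep_vars_integrable[OF _ ind int]) auto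
  have "(\<integral>\<omega>. exp (l * (emp_mean Y i s \<omega> - mean (\<nu> i))) \<partial>M) = (\<Prod>j\<in>{1..s}. \<integral>\<omega>. Z j \<omega> \<partial>M)"
    unfolding eq by (rule indep_vars_lebesgue_integral[OF _ ind int]) auto
  also have "\<dots> \<le> (\<Prod>j\<in>{1..s}. exp (c\<^sup>2 / 2))"
    by (intro prod_mono conjI le integral_nonneg) (auto simp: Z_def)
  also have "\<dots> = exp (l\<^sup>2 / (2 * real s))"
    using s by (simp add: c_def power2_eq_square field_simps flip: exp_of_nat_mult)
  finally show "(\<integral>\<omega>. exp (l * (emp_mean Y i s \<omega> - mean (\<nu> i))) \<partial>M) \<le> exp (l\<^sup>2 / (2 * real s))" .
qed

text \<open>Chernoff's bound at \<open>l = s * u\<close>, the minimiser of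
  \<open>l\<^sup>2 / (2 * s) - l * u\<close>. The sign \<open>d\<close> covers both tails, and the
  bound is written as a power with exponent \<open>s\<close> so that sums over \<open>s\<close> are
  geometric.\<close>

lemma emp_mean_tail:
  assumes i: "i \<in> {1..K}" and sg: "sub_gaussian (\<nu> i)" and s: "s \<ge> 1" and u: "u > 0"
    and d: "\<bar>d\<bar> = 1"
  shows "prob {\<omega> \<in> space M. d * (emp_mean Y i s \<omega> - mean (\<nu> i)) \<ge> u} \<le> exp (- (u\<^sup>2 / 2)) ^ s"
proof -
  define l where "l = real s * u"
  let ?X = "\<lambda>\<omega>. emp_mean Y i s \<omega> - mean (\<nu> i)"
  have d2: "d\<^sup>2 = 1" using d power2_abs[of d] by simp
  have l: "l > 0" using s u by (simp add: l_def)
  have "{\<omega> \<in> space M. d * ?X \<omega> \<ge> u} = {\<omega> \<in> space M. exp (l * d * ?X \<omega>) \<ge> exp (l * u)}"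
    using l by (simp add: mult.assoc)
  also have "prob \<dots> \<le> (\<integral>\<omega>. exp (l * d * ?X \<omega>) \<partial>M) / exp (l * u)"
    by (intro integral_Markov_inequality_measure[where A = "{}"] emp_mean_mgf[OF i sg s]) auto
  also have "\<dots> \<le> exp ((l * d)\<^sup>2 / (2 * real s)) / exp (l * u)"
    by (intro divide_right_mono emp_mean_mgf[OF i sg s]) auto
  also have "\<dots> = exp (- (u\<^sup>2 / 2)) ^ s"
    using s d2 by (simp add: l_def power2_eq_square field_simps flip: exp_of_nat_mult exp_diff)
  finally show ?thesis .
qed

text \<open>Dominated by the exponential moments at 1 and -1, through the quadratic Taylor bound for
  \<open>exp\<close>.\<close>

lemma emp_mean_square_integrable:
  assumes i: "i \<in> {1..K}" and sg: "sub_gaussian (\<nu> i)" and m0: "mean (\<nu> i) = 0" and s: "s \<ge> 1"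
  shows "integrable M (\<lambda>\<omega>. (emp_mean Y i s \<omega>)\<^sup>2)"
proof (rule Bochner_Integration.integrable_bound)
  show "integrable M (\<lambda>\<omega>. 2 * (exp (1 * (emp_mean Y i s \<omega> - mean (\<nu> i))) +
      exp (-1 * (emp_mean Y i s \<omega> - mean (\<nu> i)))))"
    by (intro integrable_mult_right Bochner_Integration.integrable_add emp_mean_mgf[OF i sg s])
  have sq: "x\<^sup>2 \<le> 2 * (exp x + exp (- x))" for x :: real
    using exp_lower_Taylor_quadratic[of "\<bar>x\<bar>"] exp_ge_zero[of x] exp_ge_zero[of "- x"]
    by (cases "x \<ge> 0") (auto simp del: exp_ge_zero)
  show "AE \<omega> in M. norm ((emp_mean Y i s \<omega>)\<^sup>2) \<le> norm (2 * (exp (1 * (emp_mean Y i s \<omega> - mean (\<nu> i))) +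
      exp (-1 * (emp_mean Y i s \<omega> - mean (\<nu> i)))))"
    using sq m0 by (intro AE_I2) (simp add: add_pos_pos abs_of_pos)
qed (use emp_mean_measurable[OF i] in simp)

text \<open>By induction on the number of rewards: the new one is centred and independent of the
  partial sum, so the cross term vanishes. Square integrability of the first reward is the preceding
  lemma at sample size 1, and the common law \<open>\<nu> i\<close> carries it to the
  others.\<close>

lemma emp_mean_second_moment:
  assumes i: "i \<in> {1..K}" and sg: "sub_gaussian (\<nu> i)" and m0: "mean (\<nu> i) = 0" and s: "s \<ge> 1"
  shows "(\<integral>\<omega>. (emp_mean Y i s \<omega>)\<^sup>2 \<partial>M) = (\<integral>\<omega>. (Y i 1 \<omega>)\<^sup>2 \<partial>M) / real s"
proof -
  let ?v = "\<integral>\<omega>. (Y i 1 \<omega>)\<^sup>2 \<partial>M"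
  have Y1: "emp_mean Y i 1 = Y i 1" by (simp add: emp_mean_def fun_eq_iff)
  have int: "integrable M (Y i j)" "(\<integral>\<omega>. Y i j \<omega> \<partial>M) = 0" if "j \<ge> 1" for j
  proof -
    have "integrable (\<nu> i) (\<lambda>x. x)" using sg unfolding sub_gaussian_def by blast
    then show "integrable M (Y i j)" using integrable_nu_iff[OF i that, of "\<lambda>x. x"] by simp
    show "(\<integral>\<omega>. Y i j \<omega> \<partial>M) = 0" using m0 integral_nu[OF i that, of "\<lambda>x. x"] by (simp add: mean_def)
  qed
  have sq: "integrable M (\<lambda>\<omega>. (Y i j \<omega>)\<^sup>2)" "(\<integral>\<omega>. (Y i j \<omega>)\<^sup>2 \<partial>M) = ?v" if "j \<ge> 1" for j
  proof -
    show "integrable M (\<lambda>\<omega>. (Y i j \<omega>)\<^sup>2)"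
      using emp_mean_square_integrable[OF i sg m0, of 1] Y1
        integrable_nu_iff[OF i that, of "\<lambda>x. x\<^sup>2"] integrable_nu_iff[OF i order_refl, of "\<lambda>x. x\<^sup>2"]
      by simp
    show "(\<integral>\<omega>. (Y i j \<omega>)\<^sup>2 \<partial>M) = ?v"
      using integral_nu[OF i that, of "\<lambda>x. x\<^sup>2"] integral_nu[OF i order_refl, of "\<lambda>x. x\<^sup>2"] by simp
  qed
  have "integrable M (\<lambda>\<omega>. (\<Sum>j=1..s. Y i j \<omega>)\<^sup>2) \<and>
      (\<integral>\<omega>. (\<Sum>j=1..s. Y i j \<omega>)\<^sup>2 \<partial>M) = real s * ?v" for s
  proof (induction s)
    case (Suc s)
    let ?S = "\<lambda>\<omega>. \<Sum>j=1..s. Y i j \<omega>"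
    have "indep_vars (\<lambda>_. borel) (Y i) (insert (Suc s) {1..s})"
      using arm_indep[OF i, of "Suc s"] by (simp add: atLeastAtMostSuc_conv)
    then have ind: "indep_var borel (Y i (Suc s)) borel ?S"
      by (intro indep_vars_sum) auto
    have S: "integrable M ?S" by (intro Bochner_Integration.integrable_sum int) simp
    have prod: "integrable M (\<lambda>\<omega>. Y i (Suc s) \<omega> * ?S \<omega>)"
      "(\<integral>\<omega>. Y i (Suc s) \<omega> * ?S \<omega> \<partial>M) = 0"
      using indep_var_integrable[OF ind int(1) S] indep_var_lebesgue_integral[OF ind int(1) S]
        int(2)[of "Suc s"] by auto
    have eq: "(\<Sum>j=1..Suc s. Y i j \<omega>)\<^sup>2 =
        (?S \<omega>)\<^sup>2 + (Y i (Suc s) \<omega>)\<^sup>2 + 2 * (Y i (Suc s) \<omega> * ?S \<omega>)" for \<omega>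
      by (simp add: power2_eq_square algebra_simps)
    show ?case
      unfolding eq using Suc prod sq[of "Suc s"] by (simp add: algebra_simps)
  qed simp
  then show ?thesis
    using s by (simp add: emp_mean_def power_mult_distrib power2_eq_square)
qed

lemma sum_upper_tail_le:
  assumes i: "i \<in> {1..K}" and sg: "sub_gaussian (\<nu> i)" and u: "u > 0"
  shows "(\<Sum>s = 1..m. prob {\<omega> \<in> space M. emp_mean Y i s \<omega> \<ge> mean (\<nu> i) + u}) \<le> 2 / u\<^sup>2"
proof -
  have "(\<Sum>s = 1..m. prob {\<omega> \<in> space M. emp_mean Y i s \<omega> \<ge> mean (\<nu> i) + u}) \<le>
      (\<Sum>s = 1..m. exp (- (u\<^sup>2 / 2)) ^ s)"
    using emp_mean_tail[OF i sg _ u, of _ 1] by (intro sum_mono) (simp add: algebra_simps)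
  then show ?thesis using sum_gauss_tail_le(1)[OF u, of m] sum_gauss_tail_le(2)[OF u] by linarith
qed

text \<open>The layer-cake bound for the negated empirical means, on whose event
  \<open>- emp_mean\<close> equals the absolute value. Integrability lets the real integrals be read
  as nonnegative ones.\<close>

lemma sum_lower_tail_expectation_le:
  fixes h h' :: "real \<Rightarrow> real"
  assumes j: "j \<in> {1..K}" and sg: "sub_gaussian (\<nu> j)" and m0: "mean (\<nu> j) = 0" and a: "a > 0"
    and h' [measurable]: "h' \<in> borel_measurable borel"
    and deriv: "\<And>x. x \<ge> a \<Longrightarrow> (h has_real_derivative h' x) (at x)"
    and pos: "\<And>x. x \<ge> a \<Longrightarrow> h' x \<ge> 0" "\<And>x. x \<ge> a \<Longrightarrow> h x \<ge> 0"
    and int: "\<And>s. s \<ge> 1 \<Longrightarrow> integrable M (\<lambda>\<omega>. h \<bar>emp_mean Y j s \<omega>\<bar> * indicator {..< - a} (emp_mean Y j s \<omega>))"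
    and B: "(\<integral>\<^sup>+y. ennreal (h' y / (exp (y\<^sup>2 / 2) - 1)) * indicator {a..} y \<partial>lborel) \<le> ennreal B" "B \<ge> 0"
  shows "(\<Sum>s = 1..m. \<integral>\<omega>. h \<bar>emp_mean Y j s \<omega>\<bar> * indicator {..< - a} (emp_mean Y j s \<omega>) \<partial>M) \<le>
    h a * (2 / a\<^sup>2) + B"
proof -
  let ?g = "\<lambda>s \<omega>. h \<bar>emp_mean Y j s \<omega>\<bar> * indicator {..< - a} (emp_mean Y j s \<omega>)"
  have g0: "?g s \<omega> \<ge> 0" for s \<omega> using pos(2) by (auto simp: indicator_def)
  have "ennreal (\<Sum>s = 1..m. \<integral>\<omega>. ?g s \<omega> \<partial>M) = (\<Sum>s = 1..m. ennreal (\<integral>\<omega>. ?g s \<omega> \<partial>M))"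
    using g0 by (intro sum_ennreal[symmetric] Bochner_Integration.integral_nonneg)
  also have "\<dots> = (\<Sum>s = 1..m. \<integral>\<^sup>+\<omega>. ?g s \<omega> \<partial>M)"
    using g0 int by (intro sum.cong refl nn_integral_eq_integral[symmetric]) auto
  also have "\<dots> = (\<Sum>s = 1..m. \<integral>\<^sup>+\<omega>. ennreal (h (- emp_mean Y j s \<omega>)) *
      indicator {a<..} (- emp_mean Y j s \<omega>) \<partial>M)"
    using a by (intro sum.cong refl nn_integral_cong) (auto simp: indicator_def)
  also have "\<dots> \<le> ennreal (h a * (2 / a\<^sup>2)) +
      (\<integral>\<^sup>+y. ennreal (h' y / (exp (y\<^sup>2 / 2) - 1)) * indicator {a..} y \<partial>lborel)"
  proof (rule sum_nn_integral_gauss_tail_le)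
    show "prob {\<omega> \<in> space M. - emp_mean Y j s \<omega> \<ge> y} \<le> exp (- (y\<^sup>2 / 2)) ^ s"
      if "s \<in> {1..m}" "y \<ge> a" for s y
      using emp_mean_tail[OF j sg, of s y "-1"] that a m0 by simp
  qed (use a j deriv pos h' in auto)
  also have "\<dots> \<le> ennreal (h a * (2 / a\<^sup>2)) + ennreal B"
    by (intro add_left_mono B)
  also have "\<dots> = ennreal (h a * (2 / a\<^sup>2) + B)"
    using pos(2)[of a] B by (intro ennreal_plus[symmetric]) auto
  finally show ?thesis using pos(2)[of a] B by (subst (asm) ennreal_le_iff) auto
qed

text \<open>Domination by a multiple of the square. The indicator hides the potential below
  \<open>a\<close>, where a logarithm in its denominator may vanish.\<close>

lemma truncated_emp_mean_integrable:
  fixes h :: "real \<Rightarrow> real"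
  assumes j: "j \<in> {1..K}" and sg: "sub_gaussian (\<nu> j)" and m0: "mean (\<nu> j) = 0" and s: "s \<ge> 1"
    and h [measurable]: "h \<in> borel_measurable borel"
    and le: "\<And>x. x \<ge> a \<Longrightarrow> 0 \<le> h x \<and> h x \<le> C * x\<^sup>2"
  shows "integrable M (\<lambda>\<omega>. h \<bar>emp_mean Y j s \<omega>\<bar> * indicator {..< - a} (emp_mean Y j s \<omega>))"
proof (rule Bochner_Integration.integrable_bound)
  have "(\<lambda>x. h \<bar>x\<bar> * indicator {..< - a} x) \<in> borel_measurable borel" by measurable
  from measurable_compose[OF emp_mean_measurable[OF j] this]
  show "(\<lambda>\<omega>. h \<bar>emp_mean Y j s \<omega>\<bar> * indicator {..< - a} (emp_mean Y j s \<omega>)) \<in> borel_measurable M" .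
  show "integrable M (\<lambda>\<omega>. C * (emp_mean Y j s \<omega>)\<^sup>2)"
    by (intro integrable_mult_right emp_mean_square_integrable j sg m0 s)
  show "AE \<omega> in M. norm (h \<bar>emp_mean Y j s \<omega>\<bar> * indicator {..< - a} (emp_mean Y j s \<omega>)) \<le>
      norm (C * (emp_mean Y j s \<omega>)\<^sup>2)"
  proof (intro AE_I2)
    fix \<omega>
    have "a \<le> \<bar>x\<bar>" if "x < - a" for x :: real using that by linarith
    then show "norm (h \<bar>emp_mean Y j s \<omega>\<bar> * indicator {..< - a} (emp_mean Y j s \<omega>)) \<le>
        norm (C * (emp_mean Y j s \<omega>)\<^sup>2)"
      using le[of "\<bar>emp_mean Y j s \<omega>\<bar>"] by (auto simp: indicator_def)
  qed
qed

section \<open>Gaps and optimal arms\<close>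

lemma gap_nonneg: "i \<in> {1..K} \<Longrightarrow> gap K \<nu> i \<ge> 0"
  unfolding gap_def opt_mean_def by (simp add: Max_ge)

lemma exists_optimal_arm: "\<exists>j\<in>{1..K}. mean (\<nu> j) = opt_mean K \<nu>"
proof -
  have "opt_mean K \<nu> \<in> (\<lambda>i. mean (\<nu> i)) ` {1..K}"
    unfolding opt_mean_def using K_pos by (intro Max_in) auto
  then show ?thesis by auto
qed

lemma min_gap_le: "ereal e \<le> min_gap K \<nu> \<Longrightarrow> i \<in> suboptimal_arms K \<nu> \<Longrightarrow> e \<le> gap K \<nu> i"
  unfolding min_gap_def by (meson INF_lower ereal_less_eq(3) order_trans)

end

section \<open>Pull counts and the randomized step\<close>

lemma pulls_Suc:
  "t \<ge> 1 \<Longrightarrow> pulls I i (Suc t) \<omega> = pulls I i t \<omega> + of_bool (I t \<omega> = i)"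
proof -
  assume t: "t \<ge> 1"
  have "{l \<in> {1..<Suc t}. I l \<omega> = i} =
      (if I t \<omega> = i then insert t {l \<in> {1..<t}. I l \<omega> = i} else {l \<in> {1..<t}. I l \<omega> = i})"
    using t by (auto simp: less_Suc_eq)
  then show ?thesis by (simp add: pulls_def)
qed

lemma pulls_le_1 [simp]: "t \<le> 1 \<Longrightarrow> pulls I i t \<omega> = 0"
  by (simp add: pulls_def)

lemma pulls_eq_sum: "pulls I i t \<omega> = (\<Sum>l\<in>{1..<t}. of_bool (I l \<omega> = i))"
  by (simp add: pulls_def Int_def flip: sum.inter_filter)

lemma pulls_le: "pulls I i t \<omega> \<le> t - 1"
proof -
  have "card {l \<in> {1..<t}. I l \<omega> = i} \<le> card {1..<t}" by (intro card_mono) auto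
  then show ?thesis by (simp add: pulls_def)
qed

lemma pulls_mono: "t \<le> t' \<Longrightarrow> pulls I i t \<omega> \<le> pulls I i t' \<omega>"
  unfolding pulls_def by (intro card_mono) auto

text \<open>Each pull of \<open>i\<close> raises its count by one. This permits the change of index
  from pulling times to sample sizes.\<close>

lemma pulls_inj: "inj_on (\<lambda>t. pulls I i t \<omega>) {t. t \<ge> 1 \<and> I t \<omega> = i}"
proof -
  have less: "pulls I i t \<omega> < pulls I i t' \<omega>" if "t < t'" "t \<ge> 1" "I t \<omega> = i" for t t'
    using pulls_mono[of "Suc t" t' I i \<omega>] pulls_Suc[of t I i \<omega>] that by simp
  show ?thesis
  proof (rule inj_onI)
    fix x y assume "x \<in> {t. t \<ge> 1 \<and> I t \<omega> = i}" "y \<in> {t. t \<ge> 1 \<and> I t \<omega> = i}"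
      "pulls I i x \<omega> = pulls I i y \<omega>"
    then show "x = y" using less[of x y] less[of y x] by (cases x y rule: linorder_cases) auto
  qed
qed

text \<open>Rewrites the sum behind a current mean, which has a random number of terms, through the
  observations at fixed times; this makes it a function of the history.\<close>

lemma sum_pulled_rewards:
  "(\<Sum>j = 1..pulls I i t \<omega>. Y i j \<omega>) =
    (\<Sum>l\<in>{1..<t}. if I l \<omega> = i then observed Y I l \<omega> else 0)"
proof (induction t)
  case (Suc t)
  show ?case
  proof (cases "t = 0")
    case False
    with Suc pulls_Suc[of t I i \<omega>] show ?thesis by (auto simp: observed_def)
  qed simp
qed simp

section \<open>Measurability with respect to the past\<close>

context randomized_policy
begin

lemma I_measurable_UNIV: "t \<ge> 1 \<Longrightarrow> I t \<in> measurable M (count_space UNIV)"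
  by (rule measurable_compose[OF I_measurable]) auto

lemma I_eq_sets [measurable]: "t \<ge> 1 \<Longrightarrow> {\<omega> \<in> space M. I t \<omega> = i} \<in> sets M"
  using measurable_sets[OF I_measurable_UNIV, of t "{i}"] by (simp add: vimage_def Int_def conj_commute)

lemma I_range: "t \<ge> 1 \<Longrightarrow> \<omega> \<in> space M \<Longrightarrow> I t \<omega> \<in> {1..K}"
  using measurable_space[OF I_measurable] by auto

lemma pulls_measurable: "pulls I i t \<in> measurable M (count_space UNIV)"
proof (induction t)
  case (Suc t)
  show ?case
  proof (cases "t = 0")
    case False
    then have "t \<ge> 1" by simp
    have "(\<lambda>\<omega>. pulls I i t \<omega> + of_bool (I t \<omega> = i)) \<in> measurable M (count_space UNIV)"
      using Suc I_measurable_UNIV[OF \<open>t \<ge> 1\<close>] by measurable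
    then show ?thesis using pulls_Suc[OF \<open>t \<ge> 1\<close>, of I i] by (simp add: fun_eq_iff cong: measurable_cong)
  qed (simp add: pulls_def[abs_def])
qed (simp add: pulls_def[abs_def])

lemma observed_measurable:
  assumes "t \<ge> 1"
  shows "observed Y I t \<in> borel_measurable M"
  unfolding observed_def[abs_def]
\<comment> \<open>Arm and sample index are both random, so the map is split over their countably
  many values; the arm is confined to \<open>{1..K}\<close>, where the rewards are known to be
  measurable.\<close>
proof (rule measurable_compose_countable'[OF _ I_measurable[OF assms]])
  fix i assume i: "i \<in> {1..K}"
  show "(\<lambda>\<omega>. Y i (Suc (pulls I i t \<omega>)) \<omega>) \<in> borel_measurable M"
    by (rule measurable_compose_countable[OF _ pulls_measurable]) (use i in simp)
qed simp

lemma history_measurable: "history Y I t \<in> measurable M (history_space t)"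
  unfolding history_def[abs_def] history_space_def
  by (intro measurable_restrict measurable_Pair I_measurable_UNIV observed_measurable) auto

lemma past_subalgebra: "finite_measure_subalgebra M (past M Y I t)"
proof
  have "sets (past M Y I t) \<subseteq> sets M"
    using measurable_sets[OF history_measurable] measurable_space[OF history_measurable]
    unfolding past_def by (subst sets_vimage_algebra2) auto
  then show "subalgebra M (past M Y I t)"
    by (simp add: subalgebra_def past_def)
qed

text \<open>Needed to take functions of the current means out of a conditional expectation.
  \<open>F\<close> recomputes the mean from a history: the sum of the rewards recorded for arm
  \<open>i\<close>, divided by their number.\<close>

lemma cur_mean_past_measurable: "cur_mean Y I i t \<in> borel_measurable (past M Y I t)"
proof -
  define F where "F = (\<lambda>h :: nat \<Rightarrow> nat \<times> real.
    1 / (\<Sum>l\<in>{1..<t}. if fst (h l) = i then 1 else 0) *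
      (\<Sum>l\<in>{1..<t}. if fst (h l) = i then snd (h l) else 0))"
  have [measurable]: "(\<lambda>h. h l) \<in> measurable (history_space t) (count_space UNIV \<Otimes>\<^sub>M borel)"
    if "l \<in> {1..<t}" for l
    unfolding history_space_def by (rule measurable_component_singleton[OF that])
  have F: "F \<in> borel_measurable (history_space t)"
    unfolding F_def by measurable
  have H: "history Y I t \<in> measurable (past M Y I t) (history_space t)"
    unfolding past_def using measurable_space[OF history_measurable]
    by (intro measurable_vimage_algebra1) auto
  have "cur_mean Y I i t \<omega> = F (history Y I t \<omega>)" for \<omega>
  proof -
    have "real (pulls I i t \<omega>) = (\<Sum>l\<in>{1..<t}. if fst (history Y I t \<omega> l) = i then 1 else 0)"
      unfolding pulls_eq_sum of_nat_sum by (intro sum.cong) (auto simp: history_def)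
    moreover have "(\<Sum>j = 1..pulls I i t \<omega>. Y i j \<omega>) =
        (\<Sum>l\<in>{1..<t}. if fst (history Y I t \<omega> l) = i then snd (history Y I t \<omega> l) else 0)"
      unfolding sum_pulled_rewards by (intro sum.cong) (auto simp: history_def)
    ultimately show ?thesis unfolding cur_mean_def emp_mean_def F_def by simp
  qed
  then have "cur_mean Y I i t = (\<lambda>\<omega>. F (history Y I t \<omega>))" by (rule ext)
  then show ?thesis using measurable_compose[OF H F] by (simp only:)
qed

lemma cur_mean_measurable: "cur_mean Y I i t \<in> borel_measurable M"
proof -
  interpret finite_measure_subalgebra M "past M Y I t" by (rule past_subalgebra)
  show ?thesis by (rule measurable_from_subalg[OF subalg cur_mean_past_measurable])
qed

section \<open>The regret as a sum of expected pull counts\<close>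

lemma regret_eq:
  "regret M K \<nu> I n = (\<Sum>i = 1..K. gap K \<nu> i * (\<Sum>t = 1..n. prob {\<omega> \<in> space M. I t \<omega> = i}))"
proof -
  have one: "(\<Sum>i = 1..K. f i * indicat_real {\<omega> \<in> space M. I t \<omega> = i} \<omega>) = f (I t \<omega>)"
    if "t \<ge> 1" "\<omega> \<in> space M" for t \<omega> and f :: "nat \<Rightarrow> real"
  proof -
    have "(\<Sum>i = 1..K. f i * indicat_real {\<omega> \<in> space M. I t \<omega> = i} \<omega>) =
        (\<Sum>i = 1..K. if i = I t \<omega> then f i else 0)"
      using that by (intro sum.cong) (auto simp: indicator_def)
    then show ?thesis using I_range[OF that] by simp
  qed
  have ex: "(\<integral>\<omega>. f (I t \<omega>) \<partial>M) = (\<Sum>i = 1..K. f i * prob {\<omega> \<in> space M. I t \<omega> = i})"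
    if t: "t \<ge> 1" for t and f :: "nat \<Rightarrow> real"
  proof -
    have "(\<integral>\<omega>. f (I t \<omega>) \<partial>M) =
        (\<integral>\<omega>. (\<Sum>i = 1..K. f i * indicat_real {\<omega> \<in> space M. I t \<omega> = i} \<omega>) \<partial>M)"
      using one[OF t] by (intro Bochner_Integration.integral_cong) auto
    also have "\<dots> = (\<Sum>i = 1..K. f i * prob {\<omega> \<in> space M. I t \<omega> = i})"
    proof -
      have "integrable M (indicat_real {\<omega> \<in> space M. I t \<omega> = i})" for i
        using I_eq_sets[OF t] by (simp add: integrable_indicator_iff less_top[symmetric])
      then show ?thesis using t by (subst Bochner_Integration.integral_sum) auto
    qed
    finally show ?thesis .
  qed
  have "real n * opt_mean K \<nu> = (\<Sum>t = 1..n. \<Sum>i = 1..K. opt_mean K \<nu> * prob {\<omega> \<in> space M. I t \<omega> = i})"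
  proof -
    have "(\<Sum>i = 1..K. opt_mean K \<nu> * prob {\<omega> \<in> space M. I t \<omega> = i}) = opt_mean K \<nu>" if "t \<ge> 1" for t
      using ex[OF that, of "\<lambda>_. opt_mean K \<nu>"] by (simp add: prob_space)
    then show ?thesis by simp
  qed
  moreover have "(\<Sum>t = 1..n. \<integral>\<omega>. mean (\<nu> (I t \<omega>)) \<partial>M) =
      (\<Sum>t = 1..n. \<Sum>i = 1..K. mean (\<nu> i) * prob {\<omega> \<in> space M. I t \<omega> = i})"
    using ex[of _ "\<lambda>i. mean (\<nu> i)"] by simp
  ultimately have "regret M K \<nu> I n =
      (\<Sum>t = 1..n. \<Sum>i = 1..K. gap K \<nu> i * prob {\<omega> \<in> space M. I t \<omega> = i})"
    by (simp add: regret_def gap_def left_diff_distrib sum_subtractf)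
  then show ?thesis by (subst (asm) sum.swap) (simp add: sum_distrib_left)
qed

lemma regret_le:
  assumes "\<And>i. i \<in> suboptimal_arms K \<nu> \<Longrightarrow>
    gap K \<nu> i * (\<Sum>t = 1..n. prob {\<omega> \<in> space M. I t \<omega> = i}) \<le> b i"
  shows "regret M K \<nu> I n \<le> (\<Sum>i\<in>suboptimal_arms K \<nu>. b i)"
proof -
  have "regret M K \<nu> I n = (\<Sum>i\<in>suboptimal_arms K \<nu>.
      gap K \<nu> i * (\<Sum>t = 1..n. prob {\<omega> \<in> space M. I t \<omega> = i}))"
    unfolding regret_eq
  proof (rule sum.mono_neutral_right)
    show "\<forall>i\<in>{1..K} - suboptimal_arms K \<nu>.
        gap K \<nu> i * (\<Sum>t = 1..n. prob {\<omega> \<in> space M. I t \<omega> = i}) = 0"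
      using gap_nonneg by (force simp: suboptimal_arms_def)
  qed (auto simp: suboptimal_arms_def)
  also have "\<dots> \<le> (\<Sum>i\<in>suboptimal_arms K \<nu>. b i)"
    using assms by (rule sum_mono)
  finally show ?thesis .
qed

end

section \<open>Charging the pulls of a suboptimal arm\<close>

context potential_policy
begin

text \<open>Due to the initial round. Hence after time \<open>K\<close> no current mean takes the
  default value 0 that \<open>emp_mean\<close> has at sample size 0.\<close>

lemma pulls_ge_1:
  assumes "t \<ge> K + 1" "i \<in> {1..K}" "\<omega> \<in> space M"
  shows "pulls I i t \<omega> \<ge> 1"
proof -
  have "{i} \<subseteq> {l \<in> {1..<t}. I l \<omega> = i}" using assms initial[of i \<omega>] by auto
  then have "card {i} \<le> pulls I i t \<omega>" unfolding pulls_def by (intro card_mono) auto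
  then show ?thesis by simp
qed

text \<open>Along the pulls of \<open>i\<close> the counts are distinct and lie in
  \<open>{1..n-1}\<close>, since only strictly earlier pulls are counted. The bound is pointwise, so
  the dependence of the policy on the rewards causes no difficulty.\<close>

lemma sum_cur_mean_le:
  fixes h :: "real \<Rightarrow> real"
  assumes h: "\<And>x. h x \<ge> 0" and i: "i \<in> {1..K}" and \<omega>: "\<omega> \<in> space M"
  shows "(\<Sum>t = K+1..n. h (cur_mean Y I i t \<omega>) * of_bool (I t \<omega> = i)) \<le>
    (\<Sum>s = 1..n-1. h (emp_mean Y i s \<omega>))"
proof -
  let ?T = "{t \<in> {K+1..n}. I t \<omega> = i}"
  have "(\<Sum>t = K+1..n. h (cur_mean Y I i t \<omega>) * of_bool (I t \<omega> = i)) =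
      (\<Sum>t\<in>?T. h (emp_mean Y i (pulls I i t \<omega>) \<omega>))"
    by (intro sum.mono_neutral_cong_right) (auto simp: cur_mean_def)
  also have "\<dots> = (\<Sum>s\<in>(\<lambda>t. pulls I i t \<omega>) ` ?T. h (emp_mean Y i s \<omega>))"
    by (subst sum.reindex) (auto intro: inj_on_subset[OF pulls_inj])
  also have "\<dots> \<le> (\<Sum>s = 1..n-1. h (emp_mean Y i s \<omega>))"
  proof (intro sum_mono2)
    show "(\<lambda>t. pulls I i t \<omega>) ` ?T \<subseteq> {1..n-1}"
    proof (rule image_subsetI)
      fix t assume t: "t \<in> ?T"
      have "pulls I i t \<omega> \<le> n - 1" using pulls_le[of I i t \<omega>] t by (auto intro: order_trans)
      then show "pulls I i t \<omega> \<in> {1..n-1}" using pulls_ge_1[of t i \<omega>] t i \<omega> by auto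
    qed
  qed (use h in auto)
  finally show ?thesis .
qed

text \<open>On the exploration event the probabilities of pulling \<open>i\<close> and \<open>j\<close> are in the ratio of
  \<open>\<psi> \<bar>X\<^sub>j\<bar>\<close> to \<open>\<psi> \<bar>X\<^sub>i\<bar>\<close>, which charges the pulls of \<open>i\<close> to those of \<open>j\<close>.\<close>

lemma explore_pull_le:
  fixes w :: "real \<Rightarrow> real" and c :: real
  defines "g \<equiv> \<lambda>x. \<psi> \<bar>x\<bar> * indicator {..< - \<epsilon> / 2} x"
  assumes t: "t \<ge> K + 1" and i: "i \<in> {1..K}" and j: "j \<in> {1..K}"
    and psi_meas [measurable]: "\<psi> \<in> borel_measurable borel"
    and psi_pos: "\<And>x. x < - \<epsilon> / 2 \<Longrightarrow> \<psi> \<bar>x\<bar> > 0"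
    and w_meas [measurable]: "w \<in> borel_measurable borel"
    and w_01: "\<And>x. 0 \<le> w x" "\<And>x. w x \<le> 1"
    and w_zero: "\<And>x. x \<ge> - \<epsilon> / 2 \<Longrightarrow> w x = 0"
    and w_le: "\<And>x. x < - \<epsilon> / 2 \<Longrightarrow> w x \<le> c * \<psi> \<bar>x\<bar>"
    and c: "c \<ge> 0"
    and int_g: "\<And>s. s \<ge> 1 \<Longrightarrow> integrable M (\<lambda>\<omega>. g (emp_mean Y j s \<omega>))"
  shows "integrable M (\<lambda>\<omega>. g (cur_mean Y I j t \<omega>) * of_bool (I t \<omega> = j))"
    and "(\<integral>\<omega>. w (cur_mean Y I i t \<omega>) * of_bool (I t \<omega> = i) \<partial>M) \<le>
      c * (\<integral>\<omega>. g (cur_mean Y I j t \<omega>) * of_bool (I t \<omega> = j) \<partial>M)"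
proof -
  define X where "X = (\<lambda>k. cur_mean Y I k t)"
  define A where "A = (\<lambda>k. {\<omega> \<in> space M. I t \<omega> = k})"
  define E where "E = {\<omega> \<in> space M. \<forall>k\<in>{1..K}. X k \<omega> < - \<epsilon> / 2}"
  define P where "P = (\<lambda>k. real_cond_exp M (past M Y I t) (indicator (A k)))"
  have P_eq: "P k = real_cond_exp M (past M Y I t) (indicator (A k))" for k by (simp add: P_def)
  have t1: "t \<ge> 1" using t by simp
  interpret past: finite_measure_subalgebra M "past M Y I t" by (rule past_subalgebra)
  have XF [measurable]: "X k \<in> borel_measurable (past M Y I t)" for k
    unfolding X_def by (rule cur_mean_past_measurable)
  have [measurable]: "X k \<in> borel_measurable M" for k
    unfolding X_def by (rule cur_mean_measurable)
  have EF: "E \<in> sets (past M Y I t)"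
  proof -
    have "E = {\<omega> \<in> space (past M Y I t). \<forall>k\<in>{1..K}. X k \<omega> < - \<epsilon> / 2}"
      by (simp add: E_def past_def)
    then show ?thesis by simp
  qed
  then have [measurable]: "E \<in> sets M" using past.subalg by (auto simp: subalgebra_def)
  have [measurable]: "A k \<in> sets M" for k
    unfolding A_def using t1 by (rule I_eq_sets)
  have [measurable]: "g \<in> borel_measurable borel" unfolding g_def by measurable
  have g0: "g x \<ge> 0" for x using psi_pos[of x] by (auto simp: g_def indicator_def)
  have A: "of_bool (I t \<omega> = k) = indicat_real (A k) \<omega>" if "\<omega> \<in> space M" for \<omega> k
    using that by (simp add: A_def indicator_def)
  \<comment> \<open>The sample size is random, so integrability comes from dominating by the sum
    over all its possible values.\<close>
  have dom: "g (X j \<omega>) \<le> (\<Sum>s = 1..t-1. g (emp_mean Y j s \<omega>))" if "\<omega> \<in> space M" for \<omega>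
    unfolding X_def cur_mean_def
    using pulls_ge_1[OF t j that] pulls_le[of I j t \<omega>] g0
    by (intro member_le_sum) auto
  have int1: "integrable M (\<lambda>\<omega>. \<Sum>s = 1..t-1. g (emp_mean Y j s \<omega>))"
    using int_g by (intro Bochner_Integration.integrable_sum) auto
  have int2: "integrable M (\<lambda>\<omega>. g (X j \<omega>) * indicator (A j) \<omega>)"
    using dom g0
    by (intro Bochner_Integration.integrable_bound[OF int1] AE_I2)
       (auto simp: indicator_def sum_nonneg)
  then show "integrable M (\<lambda>\<omega>. g (cur_mean Y I j t \<omega>) * of_bool (I t \<omega> = j))"
    by (simp add: A X_def cong: Bochner_Integration.integrable_cong)
  \<comment> \<open>Both sides are restricted to the exploration event \<open>E\<close>, which
    belongs to the past and on which the pulling probabilities are explicit.\<close>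
  define fi where "fi = (\<lambda>\<omega>. w (X i \<omega>) * indicator E \<omega>)"
  define fj where "fj = (\<lambda>\<omega>. c * g (X j \<omega>) * indicator E \<omega>)"
  have fi_F [measurable]: "fi \<in> borel_measurable (past M Y I t)"
    unfolding fi_def using EF by measurable
  have fj_F [measurable]: "fj \<in> borel_measurable (past M Y I t)"
    unfolding fj_def using EF by measurable
  have [measurable]: "fi \<in> borel_measurable M" "fj \<in> borel_measurable M"
    unfolding fi_def fj_def by measurable
  have int_i: "integrable M (\<lambda>\<omega>. fi \<omega> * indicator (A i) \<omega>)"
    by (rule integrable_const_bound[where B = 1])
       (use w_01 in \<open>auto simp: fi_def indicator_def\<close>)
  have int_j: "integrable M (\<lambda>\<omega>. fj \<omega> * indicator (A j) \<omega>)"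
    by (rule Bochner_Integration.integrable_bound[OF integrable_mult_right[OF int2, of c]])
       (use c g0 in \<open>auto simp: fj_def indicator_def\<close>)
  \<comment> \<open>Since \<open>fi\<close> and \<open>fj\<close> are known to the past, each pull
    indicator may be replaced by its conditional probability inside the integral.\<close>
  note cond_i = past.real_cond_exp_intg[OF int_i fi_F, folded P_eq]
  note cond_j = past.real_cond_exp_intg[OF int_j fj_F, folded P_eq]
  have ratio: "AE \<omega> in M. fi \<omega> * P i \<omega> \<le> fj \<omega> * P j \<omega>"
    using explore[OF t i] explore[OF t j]
  proof eventually_elim
    case (elim \<omega>)
    show ?case
    proof (cases "\<omega> \<in> E")
      case True
      then have low: "\<And>k. k \<in> {1..K} \<Longrightarrow> X k \<omega> < - \<epsilon> / 2" by (simp add: E_def)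
      define S where "S = (\<Sum>k = 1..K. 1 / \<psi> \<bar>X k \<omega>\<bar>)"
      have S: "S > 0" unfolding S_def using psi_pos low i by (intro sum_pos) auto
      have none: "\<not> (\<exists>k\<in>{1..K}. cur_mean Y I k t \<omega> \<ge> - \<epsilon> / 2)"
        using low by (force simp: X_def not_le)
      have Pi: "P i \<omega> = 1 / \<psi> \<bar>X i \<omega>\<bar> / S" and Pj: "P j \<omega> = 1 / \<psi> \<bar>X j \<omega>\<bar> / S"
        using elim none by (simp_all only: P_def A_def S_def X_def if_True simp_thms)
      \<comment> \<open>The normalisation \<open>S\<close> is common to both arms. The hypothesis on
        \<open>w\<close> cancels the potential of \<open>i\<close>, and the factor \<open>g\<close>
        cancels that of \<open>j\<close>, so both sides are compared with
        \<open>c / S\<close>.\<close>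
      have "fi \<omega> * P i \<omega> = w (X i \<omega>) / \<psi> \<bar>X i \<omega>\<bar> / S"
        using True by (simp add: fi_def Pi)
      also have "\<dots> \<le> c / S"
        using w_le[OF low[OF i]] psi_pos[OF low[OF i]] S
        by (intro divide_right_mono) (auto simp: pos_divide_le_eq)
      also have "\<dots> = fj \<omega> * P j \<omega>"
        using True low[OF j] psi_pos[OF low[OF j]] by (simp add: fj_def Pj g_def)
      finally show ?thesis .
    qed (simp add: fi_def fj_def)
  qed
  have "(\<integral>\<omega>. w (X i \<omega>) * of_bool (I t \<omega> = i) \<partial>M) = (\<integral>\<omega>. fi \<omega> * indicator (A i) \<omega> \<partial>M)"
  proof (rule Bochner_Integration.integral_cong[OF refl])
    fix \<omega> assume \<omega>: "\<omega> \<in> space M"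
    \<comment> \<open>If some mean reached the threshold, the greedy rule would pull an arm whose
      mean reaches it too, and there \<open>w\<close> is 0.\<close>
    have "\<omega> \<in> E" if "I t \<omega> = i" "w (X i \<omega>) \<noteq> 0"
    proof (rule ccontr)
      assume "\<omega> \<notin> E"
      then obtain k where k: "k \<in> {1..K}" "cur_mean Y I k t \<omega> \<ge> - \<epsilon> / 2"
        using \<omega> by (auto simp: E_def X_def not_less)
      then have "is_arg_max (\<lambda>i. cur_mean Y I i t \<omega>) (\<lambda>i. i \<in> {1..K}) (I t \<omega>)"
        using greedy[OF t \<omega>] by blast
      then have "cur_mean Y I k t \<omega> \<le> X i \<omega>"
        using k(1) that(1) by (auto simp: is_arg_max_linorder X_def)
      then show False using w_zero[of "X i \<omega>"] that(2) k(2) by simp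
    qed
    then show "w (X i \<omega>) * of_bool (I t \<omega> = i) = fi \<omega> * indicator (A i) \<omega>"
      using \<omega> by (auto simp: fi_def A_def indicator_def)
  qed
  also have "\<dots> = (\<integral>\<omega>. fi \<omega> * P i \<omega> \<partial>M)" using cond_i(2) by simp
  also have "\<dots> \<le> (\<integral>\<omega>. fj \<omega> * P j \<omega> \<partial>M)"
    using cond_i(1) cond_j(1) ratio by (intro integral_mono_AE) simp_all
  also have "\<dots> = (\<integral>\<omega>. fj \<omega> * indicator (A j) \<omega> \<partial>M)" using cond_j(2) by simp
  also have "\<dots> \<le> (\<integral>\<omega>. c * (g (X j \<omega>) * indicator (A j) \<omega>) \<partial>M)"
    using c g0 int2 int_j by (intro integral_mono) (auto simp: fj_def indicator_def)
  also have "\<dots> = c * (\<integral>\<omega>. g (X j \<omega>) * of_bool (I t \<omega> = j) \<partial>M)"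
    by (simp add: A cong: Bochner_Integration.integral_cong)
  finally show "(\<integral>\<omega>. w (cur_mean Y I i t \<omega>) * of_bool (I t \<omega> = i) \<partial>M) \<le>
      c * (\<integral>\<omega>. g (cur_mean Y I j t \<omega>) * of_bool (I t \<omega> = j) \<partial>M)"
    by (simp only: X_def)
qed

text \<open>Each pull of \<open>i\<close> after the initial round is split with weights
  \<open>1 - w\<close> and \<open>w\<close> at the current mean. The first share is reindexed by the
  samples of \<open>i\<close>; the second is charged to pulls of \<open>j\<close> at rate
  \<open>c\<close> and reindexed by the samples of \<open>j\<close>.\<close>

lemma expected_pulls_le:
  fixes w :: "real \<Rightarrow> real" and c :: real
  defines "g \<equiv> \<lambda>x. \<psi> \<bar>x\<bar> * indicator {..< - \<epsilon> / 2} x"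
  assumes i: "i \<in> {1..K}" and j: "j \<in> {1..K}"
    and psi_meas [measurable]: "\<psi> \<in> borel_measurable borel"
    and psi_pos: "\<And>x. x < - \<epsilon> / 2 \<Longrightarrow> \<psi> \<bar>x\<bar> > 0"
    and w_meas [measurable]: "w \<in> borel_measurable borel"
    and w_01: "\<And>x. 0 \<le> w x" "\<And>x. w x \<le> 1"
    and w_zero: "\<And>x. x \<ge> - \<epsilon> / 2 \<Longrightarrow> w x = 0"
    and w_le: "\<And>x. x < - \<epsilon> / 2 \<Longrightarrow> w x \<le> c * \<psi> \<bar>x\<bar>"
    and c: "c \<ge> 0"
    and int_g: "\<And>s. s \<ge> 1 \<Longrightarrow> integrable M (\<lambda>\<omega>. g (emp_mean Y j s \<omega>))"
  shows "(\<Sum>t = 1..n. prob {\<omega> \<in> space M. I t \<omega> = i}) \<le>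
    1 + (\<Sum>s = 1..n-1. \<integral>\<omega>. 1 - w (emp_mean Y i s \<omega>) \<partial>M) +
      c * (\<Sum>s = 1..n-1. \<integral>\<omega>. g (emp_mean Y j s \<omega>) \<partial>M)"
proof -
  let ?u = "\<lambda>t \<omega>. of_bool (I t \<omega> = i) :: real"
  let ?v = "\<lambda>t \<omega>. of_bool (I t \<omega> = j) :: real"
  have g0: "g x \<ge> 0" for x using psi_pos[of x] by (auto simp: g_def indicator_def)
  have [measurable]: "g \<in> borel_measurable borel" unfolding g_def by measurable
  have [measurable]: "cur_mean Y I k t \<in> borel_measurable M" for k t by (rule cur_mean_measurable)
  have [measurable]: "emp_mean Y i s \<in> borel_measurable M" for s using i by (rule emp_mean_measurable)
  have u_meas: "?u t \<in> borel_measurable M" if "t \<ge> 1" for t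
    using I_measurable_UNIV[OF that] by measurable
  have prob_u: "prob {\<omega> \<in> space M. I t \<omega> = i} = (\<integral>\<omega>. ?u t \<omega> \<partial>M)" if "t \<ge> 1" for t
  proof -
    have "(\<integral>\<omega>. ?u t \<omega> \<partial>M) = (\<integral>\<omega>. indicat_real {\<omega> \<in> space M. I t \<omega> = i} \<omega> \<partial>M)"
      by (intro Bochner_Integration.integral_cong) (auto simp: indicator_def)
    then show ?thesis using that by simp
  qed
  have bnd: "integrable M (\<lambda>\<omega>. h \<omega> * ?u t \<omega>)"
    if "t \<ge> 1" "h \<in> borel_measurable M" "\<And>\<omega>. 0 \<le> h \<omega>" "\<And>\<omega>. h \<omega> \<le> 1" for h :: "'a \<Rightarrow> real" and t
    using that u_meas[OF that(1)] by (intro integrable_const_bound[where B = 1]) auto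
  \<comment> \<open>Only an inequality, because the horizon \<open>n\<close> may end before the
    initial round does. That round pulls \<open>i\<close> exactly once, which gives the summand
    1.\<close>
  have "(\<Sum>t = 1..n. prob {\<omega> \<in> space M. I t \<omega> = i}) \<le>
      (\<Sum>t = 1..K. prob {\<omega> \<in> space M. I t \<omega> = i}) + (\<Sum>t = K+1..n. prob {\<omega> \<in> space M. I t \<omega> = i})"
    by (subst sum.union_disjoint[symmetric]) (auto intro!: sum_mono2)
  also have "(\<Sum>t = 1..K. prob {\<omega> \<in> space M. I t \<omega> = i}) = (\<Sum>t = 1..K. if t = i then 1 else 0)"
  proof (intro sum.cong refl)
    fix t assume "t \<in> {1..K}"
    then have "{\<omega> \<in> space M. I t \<omega> = i} = (if t = i then space M else {})" using initial[of t] by auto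
    then show "prob {\<omega> \<in> space M. I t \<omega> = i} = (if t = i then 1 else 0)" by (simp add: prob_space)
  qed
  also have "\<dots> = 1" using i by simp
  also have "(\<Sum>t = K+1..n. prob {\<omega> \<in> space M. I t \<omega> = i}) =
      (\<Sum>t = K+1..n. (\<integral>\<omega>. (1 - w (cur_mean Y I i t \<omega>)) * ?u t \<omega> \<partial>M) +
        (\<integral>\<omega>. w (cur_mean Y I i t \<omega>) * ?u t \<omega> \<partial>M))"
  proof (intro sum.cong refl)
    fix t assume "t \<in> {K+1..n}"
    then have t: "t \<ge> 1" by simp
    show "prob {\<omega> \<in> space M. I t \<omega> = i} = (\<integral>\<omega>. (1 - w (cur_mean Y I i t \<omega>)) * ?u t \<omega> \<partial>M) +
        (\<integral>\<omega>. w (cur_mean Y I i t \<omega>) * ?u t \<omega> \<partial>M)"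
    proof -
      have "integrable M (\<lambda>\<omega>. (1 - w (cur_mean Y I i t \<omega>)) * ?u t \<omega>)"
        "integrable M (\<lambda>\<omega>. w (cur_mean Y I i t \<omega>) * ?u t \<omega>)"
        using w_01 by (intro bnd t; simp)+
      then have "(\<integral>\<omega>. (1 - w (cur_mean Y I i t \<omega>)) * ?u t \<omega> \<partial>M) +
          (\<integral>\<omega>. w (cur_mean Y I i t \<omega>) * ?u t \<omega> \<partial>M) =
          (\<integral>\<omega>. (1 - w (cur_mean Y I i t \<omega>)) * ?u t \<omega> + w (cur_mean Y I i t \<omega>) * ?u t \<omega> \<partial>M)"
        by (rule Bochner_Integration.integral_add[symmetric])
      then show ?thesis unfolding prob_u[OF t] by (simp add: left_diff_distrib)
    qed
  qed
  also have "\<dots> = (\<Sum>t = K+1..n. \<integral>\<omega>. (1 - w (cur_mean Y I i t \<omega>)) * ?u t \<omega> \<partial>M) +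
      (\<Sum>t = K+1..n. \<integral>\<omega>. w (cur_mean Y I i t \<omega>) * ?u t \<omega> \<partial>M)"
    by (rule sum.distrib)
  also have "(\<Sum>t = K+1..n. \<integral>\<omega>. (1 - w (cur_mean Y I i t \<omega>)) * ?u t \<omega> \<partial>M) \<le>
      (\<Sum>s = 1..n-1. \<integral>\<omega>. 1 - w (emp_mean Y i s \<omega>) \<partial>M)"
  proof -
    have int: "integrable M (\<lambda>\<omega>. (1 - w (cur_mean Y I i t \<omega>)) * ?u t \<omega>)" if "t \<in> {K+1..n}" for t
      using w_01 that by (intro bnd) auto
    have int': "integrable M (\<lambda>\<omega>. 1 - w (emp_mean Y i s \<omega>))" for s
      using w_01 by (intro integrable_const_bound[where B = 1]) auto
    have "(\<Sum>t = K+1..n. \<integral>\<omega>. (1 - w (cur_mean Y I i t \<omega>)) * ?u t \<omega> \<partial>M) =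
        (\<integral>\<omega>. (\<Sum>t = K+1..n. (1 - w (cur_mean Y I i t \<omega>)) * ?u t \<omega>) \<partial>M)"
      using int by (subst Bochner_Integration.integral_sum) auto
    also have "\<dots> \<le> (\<integral>\<omega>. (\<Sum>s = 1..n-1. 1 - w (emp_mean Y i s \<omega>)) \<partial>M)"
      using w_01 i
      by (intro integral_mono Bochner_Integration.integrable_sum int int'
            sum_cur_mean_le[where h = "\<lambda>x. 1 - w x"]) auto
    also have "\<dots> = (\<Sum>s = 1..n-1. \<integral>\<omega>. 1 - w (emp_mean Y i s \<omega>) \<partial>M)"
      using int' by (subst Bochner_Integration.integral_sum) auto
    finally show ?thesis .
  qed
  also have "(\<Sum>t = K+1..n. \<integral>\<omega>. w (cur_mean Y I i t \<omega>) * ?u t \<omega> \<partial>M) \<le>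
      c * (\<Sum>s = 1..n-1. \<integral>\<omega>. g (emp_mean Y j s \<omega>) \<partial>M)"
  proof -
    have g_eq: "\<psi> \<bar>x\<bar> * indicat_real {..< - \<epsilon> / 2} x = g x" for x by (simp add: g_def)
    note pull = explore_pull_le[OF _ i j psi_meas psi_pos w_meas w_01 w_zero w_le c
        int_g[unfolded g_def], unfolded g_eq]
    have int: "integrable M (\<lambda>\<omega>. g (cur_mean Y I j t \<omega>) * ?v t \<omega>)" if "t \<in> {K+1..n}" for t
      using that by (intro pull(1)) auto
    have "(\<Sum>t = K+1..n. \<integral>\<omega>. w (cur_mean Y I i t \<omega>) * ?u t \<omega> \<partial>M) \<le>
        (\<Sum>t = K+1..n. c * (\<integral>\<omega>. g (cur_mean Y I j t \<omega>) * ?v t \<omega> \<partial>M))"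
      by (intro sum_mono pull(2)) auto
    also have "\<dots> = c * (\<integral>\<omega>. (\<Sum>t = K+1..n. g (cur_mean Y I j t \<omega>) * ?v t \<omega>) \<partial>M)"
      using int by (subst Bochner_Integration.integral_sum) (auto simp: sum_distrib_left)
    also have "\<dots> \<le> c * (\<integral>\<omega>. (\<Sum>s = 1..n-1. g (emp_mean Y j s \<omega>)) \<partial>M)"
      using j g0 c
      by (intro mult_left_mono integral_mono Bochner_Integration.integrable_sum int int_g
          sum_cur_mean_le) auto
    also have "\<dots> = c * (\<Sum>s = 1..n-1. \<integral>\<omega>. g (emp_mean Y j s \<omega>) \<partial>M)"
      using int_g by (subst Bochner_Integration.integral_sum) auto
    finally show ?thesis .
  qed
  finally show ?thesis by simp
qed

text \<open>Here \<open>w\<close> is the indicator of means below \<open>- d / 2\<close>, and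
  monotonicity of the potential gives \<open>c = 1 / \<psi> (d / 2)\<close>. The weight vanishes
  above \<open>- \<epsilon> / 2\<close> because \<open>\<epsilon> <= d\<close>. The term
  \<open>8 / d\<close> is \<open>d * (2 / (d / 2)\<^sup>2)\<close>.\<close>

lemma regret_le_monotone_potential:
  assumes sg: "\<And>i. i \<in> {1..K} \<Longrightarrow> sub_gaussian (\<nu> i)" and opt: "opt_mean K \<nu> = 0"
    and eps: "0 < \<epsilon>" "\<And>i. i \<in> suboptimal_arms K \<nu> \<Longrightarrow> \<epsilon> \<le> gap K \<nu> i"
    and j: "j \<in> {1..K}"
    and psi_meas [measurable]: "\<psi> \<in> borel_measurable borel"
    and psi_pos: "\<And>x. x \<ge> \<epsilon> / 2 \<Longrightarrow> \<psi> x > 0"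
    and psi_mono: "\<And>x y. \<epsilon> / 2 \<le> x \<Longrightarrow> x \<le> y \<Longrightarrow> \<psi> x \<le> \<psi> y"
    and int: "\<And>s. s \<ge> 1 \<Longrightarrow>
      integrable M (\<lambda>\<omega>. \<psi> \<bar>emp_mean Y j s \<omega>\<bar> * indicator {..< - (\<epsilon> / 2)} (emp_mean Y j s \<omega>))"
    and S: "(\<Sum>s = 1..n-1. \<integral>\<omega>. \<psi> \<bar>emp_mean Y j s \<omega>\<bar> *
      indicator {..< - (\<epsilon> / 2)} (emp_mean Y j s \<omega>) \<partial>M) \<le> S"
  shows "regret M K \<nu> I n \<le>
    (\<Sum>i\<in>suboptimal_arms K \<nu>. gap K \<nu> i + 8 / gap K \<nu> i + gap K \<nu> i / \<psi> (gap K \<nu> i / 2) * S)"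
proof (rule regret_le)
  fix i assume i: "i \<in> suboptimal_arms K \<nu>"
  define d where "d = gap K \<nu> i"
  define w :: "real \<Rightarrow> real" where "w = indicator {..< - (d / 2)}"
  have iK: "i \<in> {1..K}" and d: "d > 0" "\<epsilon> \<le> d" and m: "mean (\<nu> i) = - d"
    using i eps opt by (auto simp: suboptimal_arms_def d_def gap_def)
  have psi_d: "\<psi> (d / 2) > 0" using d by (intro psi_pos) simp
  have "(\<Sum>t = 1..n. prob {\<omega> \<in> space M. I t \<omega> = i}) \<le>
      1 + (\<Sum>s = 1..n-1. \<integral>\<omega>. 1 - w (emp_mean Y i s \<omega>) \<partial>M) +
      1 / \<psi> (d / 2) * (\<Sum>s = 1..n-1. \<integral>\<omega>. \<psi> \<bar>emp_mean Y j s \<omega>\<bar> *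
        indicator {..< - \<epsilon> / 2} (emp_mean Y j s \<omega>) \<partial>M)"
  proof (rule expected_pulls_le[OF iK j psi_meas])
    fix x :: real assume x: "x < - \<epsilon> / 2"
    show "\<psi> \<bar>x\<bar> > 0" using x eps by (intro psi_pos) simp
    show "w x \<le> 1 / \<psi> (d / 2) * \<psi> \<bar>x\<bar>"
    proof (cases "x < - (d / 2)")
      case True
      then have "\<psi> (d / 2) \<le> \<psi> \<bar>x\<bar>" using d by (intro psi_mono) auto
      then show ?thesis using True psi_d by (simp add: w_def)
    next
      case False
      have "\<psi> \<bar>x\<bar> > 0" using x eps by (intro psi_pos) simp
      then show ?thesis using False psi_d by (simp add: w_def)
    qed
  next
    show "integrable M (\<lambda>\<omega>. \<psi> \<bar>emp_mean Y j s \<omega>\<bar> * indicator {..< - \<epsilon> / 2} (emp_mean Y j s \<omega>))"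
      if "s \<ge> 1" for s using int[OF that] by simp
  qed (use d psi_d in \<open>auto simp: w_def indicator_def\<close>)
  also have "(\<Sum>s = 1..n-1. \<integral>\<omega>. 1 - w (emp_mean Y i s \<omega>) \<partial>M) =
      (\<Sum>s = 1..n-1. prob {\<omega> \<in> space M. emp_mean Y i s \<omega> \<ge> mean (\<nu> i) + d / 2})"
  proof (intro sum.cong refl)
    fix s
    have [measurable]: "emp_mean Y i s \<in> borel_measurable M" by (rule emp_mean_measurable[OF iK])
    have "(\<integral>\<omega>. 1 - w (emp_mean Y i s \<omega>) \<partial>M) =
        (\<integral>\<omega>. indicator {\<omega> \<in> space M. emp_mean Y i s \<omega> \<ge> mean (\<nu> i) + d / 2} \<omega> \<partial>M)"
      by (intro Bochner_Integration.integral_cong) (auto simp: w_def indicator_def m)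
    then show "(\<integral>\<omega>. 1 - w (emp_mean Y i s \<omega>) \<partial>M) =
        prob {\<omega> \<in> space M. emp_mean Y i s \<omega> \<ge> mean (\<nu> i) + d / 2}"
      by simp
  qed
  also have "\<dots> \<le> 2 / (d / 2)\<^sup>2"
    using d by (intro sum_upper_tail_le iK sg) auto
  also have "1 / \<psi> (d / 2) * (\<Sum>s = 1..n-1. \<integral>\<omega>. \<psi> \<bar>emp_mean Y j s \<omega>\<bar> *
        indicator {..< - \<epsilon> / 2} (emp_mean Y j s \<omega>) \<partial>M) \<le> 1 / \<psi> (d / 2) * S"
    using S psi_d by (intro mult_left_mono) auto
  finally have "(\<Sum>t = 1..n. prob {\<omega> \<in> space M. I t \<omega> = i}) \<le> 1 + 2 / (d / 2)\<^sup>2 + 1 / \<psi> (d / 2) * S"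
    by simp
  then have "d * (\<Sum>t = 1..n. prob {\<omega> \<in> space M. I t \<omega> = i}) \<le>
      d * (1 + 2 / (d / 2)\<^sup>2 + 1 / \<psi> (d / 2) * S)"
    using d by (intro mult_left_mono) auto
  also have "\<dots> = d + 8 / d + d / \<psi> (d / 2) * S"
    using d by (simp add: field_simps power2_eq_square)
  finally show "gap K \<nu> i * (\<Sum>t = 1..n. prob {\<omega> \<in> space M. I t \<omega> = i}) \<le>
      gap K \<nu> i + 8 / gap K \<nu> i + gap K \<nu> i / \<psi> (gap K \<nu> i / 2) * S"
    by (simp only: d_def)
qed

end

section \<open>Regret bounds\<close>

text \<open>The sum over the samples of \<open>j\<close> is at most \<open>2 + B\<close>, the 2
  being the boundary term at \<open>\<epsilon> / 2\<close>, and the charging rate is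
  \<open>4 / d\<^sup>2\<close>. Each arm thus costs \<open>d + (8 + 4 * (2 + B)) / d\<close>, where
  \<open>B <= 4 * ln (3 / \<epsilon>)\<close> follows from
  \<open>1 + 8 / \<epsilon>\<^sup>2 <= 9 / \<epsilon>\<^sup>2\<close>.\<close>

lemma regret_square_potential:
  assumes "potential_policy M K \<nu> Y N U I \<epsilon> (\<lambda>x. x\<^sup>2)"
    and sg: "\<And>i. i \<in> {1..K} \<Longrightarrow> sub_gaussian (\<nu> i)" and opt: "opt_mean K \<nu> = 0"
    and eps: "0 < \<epsilon>" "\<epsilon> \<le> 1" "ereal \<epsilon> \<le> min_gap K \<nu>"
  shows "regret M K \<nu> I n \<le> (\<Sum>i\<in>suboptimal_arms K \<nu>. gap K \<nu> i + 32 / gap K \<nu> i * ln (5 / \<epsilon>))"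
proof -
  interpret potential_policy M K \<nu> Y N U I \<epsilon> "\<lambda>x. x\<^sup>2" by fact
  obtain j where j: "j \<in> {1..K}" "mean (\<nu> j) = 0" using exists_optimal_arm opt by auto
  define B where "B = 2 * ln (1 + 2 / (\<epsilon> / 2)\<^sup>2)"
  have "0 \<le> B" unfolding B_def by (intro mult_nonneg_nonneg ln_ge_zero) auto
  have int: "integrable M (\<lambda>\<omega>. \<bar>emp_mean Y j s \<omega>\<bar>\<^sup>2 * indicator {..< - (\<epsilon> / 2)} (emp_mean Y j s \<omega>))"
    if "s \<ge> 1" for s
    using that by (intro truncated_emp_mean_integrable[where C = 1 and h = "\<lambda>x. x\<^sup>2"] j sg) auto
  have S: "(\<Sum>s = 1..n-1. \<integral>\<omega>. \<bar>emp_mean Y j s \<omega>\<bar>\<^sup>2 * indicator {..< - (\<epsilon> / 2)} (emp_mean Y j s \<omega>) \<partial>M) \<le>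
      (\<epsilon> / 2)\<^sup>2 * (2 / (\<epsilon> / 2)\<^sup>2) + B"
  proof (rule sum_lower_tail_expectation_le[where h = "\<lambda>x. x\<^sup>2" and h' = "\<lambda>x. 2 * x"])
    show "(\<integral>\<^sup>+y. ennreal (2 * y / (exp (y\<^sup>2 / 2) - 1)) * indicator {\<epsilon> / 2..} y \<partial>lborel) \<le> ennreal B"
      using nn_integral_linear_gauss_sum[of "\<epsilon> / 2"] eps by (simp add: B_def ennreal_leI)
  qed (use eps j sg int \<open>0 \<le> B\<close> in \<open>auto intro!: derivative_eq_intros\<close>)
  have B: "B \<le> 4 * ln (3 / \<epsilon>)"
  proof -
    have "1 + 2 / (\<epsilon> / 2)\<^sup>2 \<le> (3 / \<epsilon>)\<^sup>2"
    proof -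
      have "\<epsilon>\<^sup>2 \<le> 1" using eps by (intro power_le_one) auto
      then have "(8 + \<epsilon>\<^sup>2) / \<epsilon>\<^sup>2 \<le> 9 / \<epsilon>\<^sup>2" by (intro divide_right_mono) auto
      then show ?thesis using eps by (simp add: power_divide add_divide_distrib)
    qed
    then have "ln (1 + 2 / (\<epsilon> / 2)\<^sup>2) \<le> ln ((3 / \<epsilon>)\<^sup>2)"
      by (subst ln_le_cancel_iff) (auto intro: add_pos_nonneg simp: eps(1))
    then show ?thesis using eps by (simp add: B_def ln_realpow)
  qed
  have ln_le: "16 + 16 * ln (3 / \<epsilon>) \<le> 32 * ln (5 / \<epsilon>)"
  proof -
    \<comment> \<open>The claim amounts to \<open>1 <= ln (25 / (3 * \<epsilon>))\<close>, which
      follows from \<open>exp 1 <= 3\<close> and \<open>\<epsilon> <= 1\<close>.\<close>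
    have "exp 1 \<le> 25 / (3 * \<epsilon>)" using mult_mono[of \<epsilon> 1 "exp 1" 3] exp_le eps by (simp add: field_simps)
    then have "1 \<le> ln (25 / (3 * \<epsilon>))" using eps by (subst ln_ge_iff) auto
    also have "25 / (3 * \<epsilon>) = (5 / \<epsilon>)\<^sup>2 / (3 / \<epsilon>)" using eps by (simp add: power2_eq_square field_simps)
    also have "ln \<dots> = ln ((5 / \<epsilon>)\<^sup>2) - ln (3 / \<epsilon>)" using eps by (intro ln_divide_pos) auto
    also have "ln ((5 / \<epsilon>)\<^sup>2) = 2 * ln (5 / \<epsilon>)" using eps by (simp add: ln_realpow)
    finally show ?thesis by simp
  qed
  have "regret M K \<nu> I n \<le> (\<Sum>i\<in>suboptimal_arms K \<nu>.
      gap K \<nu> i + 8 / gap K \<nu> i + gap K \<nu> i / (gap K \<nu> i / 2)\<^sup>2 * ((\<epsilon> / 2)\<^sup>2 * (2 / (\<epsilon> / 2)\<^sup>2) + B))"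
    using eps min_gap_le
    by (intro regret_le_monotone_potential[OF sg opt _ _ j(1) _ _ _ int S]) (auto intro: power_mono)
  also have "\<dots> \<le> (\<Sum>i\<in>suboptimal_arms K \<nu>. gap K \<nu> i + 32 / gap K \<nu> i * ln (5 / \<epsilon>))"
  proof (rule sum_mono)
    fix i assume "i \<in> suboptimal_arms K \<nu>"
    then have d: "gap K \<nu> i > 0" by (simp add: suboptimal_arms_def)
    have "gap K \<nu> i + 8 / gap K \<nu> i + gap K \<nu> i / (gap K \<nu> i / 2)\<^sup>2 * ((\<epsilon> / 2)\<^sup>2 * (2 / (\<epsilon> / 2)\<^sup>2) + B) =
        gap K \<nu> i + (8 + 4 * (2 + B)) / gap K \<nu> i"
      using d eps by (simp add: field_simps power2_eq_square)
    also have "\<dots> \<le> gap K \<nu> i + 32 * ln (5 / \<epsilon>) / gap K \<nu> i"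
      using d B ln_le by (intro add_left_mono divide_right_mono) auto
    finally show "gap K \<nu> i + 8 / gap K \<nu> i + gap K \<nu> i / (gap K \<nu> i / 2)\<^sup>2 * ((\<epsilon> / 2)\<^sup>2 * (2 / (\<epsilon> / 2)\<^sup>2) + B) \<le>
        gap K \<nu> i + 32 / gap K \<nu> i * ln (5 / \<epsilon>)" by simp
  qed
  finally show ?thesis .
qed

text \<open>Dividing by the logarithm lowers the sum over the samples of \<open>j\<close> to
  \<open>9 + 4 * LL\<close>: 3 from the boundary term and \<open>6 + 4 * LL\<close> from the
  integral. The price is the factor \<open>L = ln (2 * d / \<epsilon>)\<close> in
  \<open>1 / \<psi> (d / 2)\<close>.\<close>

lemma regret_square_over_ln_potential:
  assumes "potential_policy M K \<nu> Y N U I \<epsilon> (\<lambda>x. x\<^sup>2 / ln (4 * x / \<epsilon>))"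
    and sg: "\<And>i. i \<in> {1..K} \<Longrightarrow> sub_gaussian (\<nu> i)" and opt: "opt_mean K \<nu> = 0"
    and eps: "0 < \<epsilon>" "\<epsilon> \<le> 1" "ereal \<epsilon> \<le> min_gap K \<nu>"
  shows "regret M K \<nu> I n \<le> (\<Sum>i\<in>suboptimal_arms K \<nu>. gap K \<nu> i +
    32 * ln (2 * gap K \<nu> i / \<epsilon>) / gap K \<nu> i * (3 + ln (ln (4 / \<epsilon>))))"
proof -
  let ?psi = "\<lambda>x. x\<^sup>2 / ln (4 * x / \<epsilon>)"
  let ?psi' = "\<lambda>x. 2 * x / ln (4 * x / \<epsilon>) - x / (ln (4 * x / \<epsilon>))\<^sup>2"
  interpret potential_policy M K \<nu> Y N U I \<epsilon> ?psi by fact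
  obtain j where j: "j \<in> {1..K}" "mean (\<nu> j) = 0" using exists_optimal_arm opt by auto
  note psi = has_real_derivative_square_over_ln[OF eps(1)]
  have psi_pos: "?psi x > 0" if "\<epsilon> / 2 \<le> x" for x
    using psi(2)[OF that] that eps by (intro divide_pos_pos) auto
  have psi_le: "?psi x \<le> 3 / 2 * x\<^sup>2" if "\<epsilon> / 2 \<le> x" for x
  proof -
    have "?psi x \<le> x\<^sup>2 / (2 / 3)" using psi(2)[OF that] by (intro divide_left_mono) auto
    then show ?thesis by simp
  qed
  have psi_mono: "?psi x \<le> ?psi y" if "\<epsilon> / 2 \<le> x" "x \<le> y" for x y
  proof (rule DERIV_nonneg_imp_nondecreasing[of x y ?psi])
    fix z assume "x \<le> z"
    then have "\<epsilon> / 2 \<le> z" using that by simp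
    then show "\<exists>l. (?psi has_real_derivative l) (at z) \<and> 0 \<le> l" using psi(1,3) by blast
  qed (use that in simp)
  define LL where "LL = ln (ln (4 / \<epsilon>))"
  have "LL \<ge> 0"
  proof -
    have "exp 1 \<le> 4 / \<epsilon>" using mult_mono[of \<epsilon> 1 "exp 1" 3] exp_le eps by (simp add: field_simps)
    then have "1 \<le> ln (4 / \<epsilon>)" using eps by (subst ln_ge_iff) auto
    then show ?thesis by (simp add: LL_def)
  qed
  have int: "integrable M (\<lambda>\<omega>. ?psi \<bar>emp_mean Y j s \<omega>\<bar> * indicator {..< - (\<epsilon> / 2)} (emp_mean Y j s \<omega>))"
    if "s \<ge> 1" for s
    using that psi_pos psi_le
    by (intro truncated_emp_mean_integrable[where C = "3 / 2" and h = ?psi] j sg) (auto intro: less_imp_le)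
  have "(\<Sum>s = 1..n-1. \<integral>\<omega>. ?psi \<bar>emp_mean Y j s \<omega>\<bar> * indicator {..< - (\<epsilon> / 2)} (emp_mean Y j s \<omega>) \<partial>M) \<le>
      ?psi (\<epsilon> / 2) * (2 / (\<epsilon> / 2)\<^sup>2) + (6 + 4 * LL)"
  proof (rule sum_lower_tail_expectation_le[where h = ?psi and h' = ?psi'])
    show "(\<integral>\<^sup>+y. ennreal (?psi' y / (exp (y\<^sup>2 / 2) - 1)) * indicator {\<epsilon> / 2..} y \<partial>lborel) \<le> ennreal (6 + 4 * LL)"
      unfolding LL_def by (rule nn_integral_square_over_ln_le[OF eps(1,2)])
  qed (use eps j sg int psi psi_pos \<open>0 \<le> LL\<close> in \<open>auto intro: less_imp_le\<close>)
  also have "\<dots> \<le> 3 / 2 * (\<epsilon> / 2)\<^sup>2 * (2 / (\<epsilon> / 2)\<^sup>2) + (6 + 4 * LL)"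
    using psi_le[of "\<epsilon> / 2"] by (intro add_right_mono mult_right_mono) auto
  also have "\<dots> = 9 + 4 * LL" using eps by simp
  finally have S: "(\<Sum>s = 1..n-1. \<integral>\<omega>. ?psi \<bar>emp_mean Y j s \<omega>\<bar> *
      indicator {..< - (\<epsilon> / 2)} (emp_mean Y j s \<omega>) \<partial>M) \<le> 9 + 4 * LL" .
  have "regret M K \<nu> I n \<le> (\<Sum>i\<in>suboptimal_arms K \<nu>.
      gap K \<nu> i + 8 / gap K \<nu> i + gap K \<nu> i / ?psi (gap K \<nu> i / 2) * (9 + 4 * LL))"
    using eps min_gap_le psi_pos psi_mono
    by (intro regret_le_monotone_potential[OF sg opt _ _ j(1) _ _ _ int S]) auto
  also have "\<dots> \<le> (\<Sum>i\<in>suboptimal_arms K \<nu>. gap K \<nu> i +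
      32 * ln (2 * gap K \<nu> i / \<epsilon>) / gap K \<nu> i * (3 + LL))"
  proof (rule sum_mono)
    fix i assume i: "i \<in> suboptimal_arms K \<nu>"
    define d where "d = gap K \<nu> i"
    define L where "L = ln (2 * d / \<epsilon>)"
    have d: "d > 0" "\<epsilon> \<le> d" using i min_gap_le eps by (auto simp: suboptimal_arms_def d_def)
    have L: "2 / 3 \<le> L" using psi(2)[of "d / 2"] d by (simp add: L_def)
    \<comment> \<open>The 8 is absorbed into \<open>12 * L\<close> because
      \<open>L >= 2 / 3\<close>; the later step from 48 and 16 to 96 and 32 has a factor 2 to
      spare.\<close>
    have "8 + 4 * L * (9 + 4 * LL) \<le> 12 * L + 4 * L * (9 + 4 * LL)" using L by simp
    also have "\<dots> = L * (48 + 16 * LL)" by (simp add: algebra_simps)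
    also have "\<dots> \<le> L * (96 + 32 * LL)" using L \<open>0 \<le> LL\<close> by (intro mult_left_mono) auto
    also have "\<dots> = 32 * L * (3 + LL)" by (simp add: algebra_simps)
    finally have "8 + 4 * L * (9 + 4 * LL) \<le> 32 * L * (3 + LL)" .
    then have le: "d + (8 + 4 * L * (9 + 4 * LL)) / d \<le> d + 32 * L * (3 + LL) / d"
      using d by (intro add_left_mono divide_right_mono) auto
    have "?psi (d / 2) = d\<^sup>2 / (4 * L)" by (simp add: L_def power_divide)
    then have "d + 8 / d + d / ?psi (d / 2) * (9 + 4 * LL) = d + (8 + 4 * L * (9 + 4 * LL)) / d"
      using d L by (simp add: add_divide_distrib power2_eq_square)
    then have "d + 8 / d + d / ?psi (d / 2) * (9 + 4 * LL) \<le> d + 32 * L / d * (3 + LL)"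
      using le by simp
    then show "gap K \<nu> i + 8 / gap K \<nu> i + gap K \<nu> i / ?psi (gap K \<nu> i / 2) * (9 + 4 * LL) \<le>
        gap K \<nu> i + 32 * ln (2 * gap K \<nu> i / \<epsilon>) / gap K \<nu> i * (3 + LL)"
      by (simp only: d_def L_def)
  qed
  finally show ?thesis by (simp only: LL_def)
qed

text \<open>Without a positive threshold, the squared mean of \<open>j\<close> is bounded by its
  full second moment \<open>v / s\<close>, and the harmonic sum over \<open>s\<close> gives
  \<open>ln n\<close>.\<close>

lemma regret_square_potential_eps_zero:
  assumes "potential_policy M K \<nu> Y N U I 0 (\<lambda>x. x\<^sup>2)"
    and sg: "\<And>i. i \<in> {1..K} \<Longrightarrow> sub_gaussian (\<nu> i)" and opt: "opt_mean K \<nu> = 0"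
    and j: "j \<in> {1..K}" "mean (\<nu> j) = 0" and v: "v = (\<integral>\<omega>. (Y j 1 \<omega>)\<^sup>2 \<partial>M)" and n: "n \<ge> 1"
  shows "regret M K \<nu> I n \<le>
    (\<Sum>i\<in>suboptimal_arms K \<nu>. gap K \<nu> i + max 1 v * (4 * ln (9 * real n) / gap K \<nu> i))"
proof -
  interpret potential_policy M K \<nu> Y N U I 0 "\<lambda>x. x\<^sup>2" by fact
  have v0: "v \<ge> 0" unfolding v by (intro Bochner_Integration.integral_nonneg) auto
  have [measurable]: "emp_mean Y j s \<in> borel_measurable M" for s by (rule emp_mean_measurable[OF j(1)])
  \<comment> \<open>The shape \<open>- 0 / 2\<close> is that of \<open>- \<epsilon> / 2\<close> in
    the general bound, instantiated at \<open>\<epsilon> = 0\<close>.\<close>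
  have int: "integrable M (\<lambda>\<omega>. \<bar>emp_mean Y j s \<omega>\<bar>\<^sup>2 * indicator {..< - 0 / 2} (emp_mean Y j s \<omega>))"
    if "s \<ge> 1" for s
    using truncated_emp_mean_integrable[of j s "\<lambda>x. x\<^sup>2" 0 1] that j sg by simp
  have "(\<Sum>s = 1..n-1. \<integral>\<omega>. \<bar>emp_mean Y j s \<omega>\<bar>\<^sup>2 * indicator {..< - 0 / 2} (emp_mean Y j s \<omega>) \<partial>M) \<le>
      (\<Sum>s = 1..n-1. v / real s)"
  proof (rule sum_mono)
    fix s assume "s \<in> {1..n-1}"
    then have s: "s \<ge> 1" by simp
    have "(\<integral>\<omega>. \<bar>emp_mean Y j s \<omega>\<bar>\<^sup>2 * indicator {..< - 0 / 2} (emp_mean Y j s \<omega>) \<partial>M) \<le>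
        (\<integral>\<omega>. (emp_mean Y j s \<omega>)\<^sup>2 \<partial>M)"
      by (intro integral_mono int[OF s] emp_mean_square_integrable j sg s) (auto simp: indicator_def)
    also have "\<dots> = v / real s" unfolding v by (intro emp_mean_second_moment j sg s)
    finally show "(\<integral>\<omega>. \<bar>emp_mean Y j s \<omega>\<bar>\<^sup>2 * indicator {..< - 0 / 2} (emp_mean Y j s \<omega>) \<partial>M) \<le> v / real s" .
  qed
  also have "\<dots> = v * harm (n - 1)" by (simp add: harm_def sum_distrib_left divide_inverse)
  also have "\<dots> \<le> v * (ln (real n) + 13 / 22)"
    using harm_le_ln[of "n - 1"] n v0 by (intro mult_left_mono) auto
  finally have S: "(\<Sum>s = 1..n-1. \<integral>\<omega>. \<bar>emp_mean Y j s \<omega>\<bar>\<^sup>2 * indicator {..< - 0 / 2} (emp_mean Y j s \<omega>) \<partial>M) \<le>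
      v * (ln (real n) + 13 / 22)" .
  show ?thesis
  proof (rule regret_le)
    fix i assume i: "i \<in> suboptimal_arms K \<nu>"
    define d where "d = gap K \<nu> i"
    have iK: "i \<in> {1..K}" and d: "d > 0" and m: "mean (\<nu> i) = - d"
      using i opt by (auto simp: suboptimal_arms_def d_def gap_def)
    define T where "T = (\<lambda>u s. {\<omega> \<in> space M. emp_mean Y i s \<omega> \<ge> mean (\<nu> i) + u})"
    \<comment> \<open>A two-step approximation of \<open>min 1 (4 x\<^sup>2 / d\<^sup>2)\<close>: a single threshold at
      \<open>- d / 2\<close> leads to the coefficient \<open>8\<close> instead of \<open>32 / 5\<close>, too large for the
      constant \<open>9\<close> in the logarithm.\<close>
    define w :: "real \<Rightarrow> real"
      where "w = (\<lambda>x. 51 / 100 * indicator {..< - (d / 2)} x + 49 / 100 * indicator {..< - (7 / 20 * d)} x)"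
    have "(\<Sum>t = 1..n. prob {\<omega> \<in> space M. I t \<omega> = i}) \<le>
        1 + (\<Sum>s = 1..n-1. \<integral>\<omega>. 1 - w (emp_mean Y i s \<omega>) \<partial>M) +
        4 / d\<^sup>2 * (\<Sum>s = 1..n-1. \<integral>\<omega>. \<bar>emp_mean Y j s \<omega>\<bar>\<^sup>2 *
          indicator {..< - 0 / 2} (emp_mean Y j s \<omega>) \<partial>M)"
    proof (rule expected_pulls_le[OF iK j(1)])
      fix x :: real
      have sq: "c * d\<^sup>2 \<le> x\<^sup>2" if "x < - (a * d)" "a > 0" "c = a\<^sup>2" for a c
        using power_mono[of "a * d" "- x" 2] that d by (simp add: power_mult_distrib)
      \<comment> \<open>The total heights of \<open>w\<close> equal
        \<open>4 * x\<^sup>2 / d\<^sup>2\<close> at its two jumps: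
        \<open>4 * (7 / 20)\<^sup>2 = 49 / 100\<close> and
        \<open>4 * (1 / 2)\<^sup>2 = 1\<close>.\<close>
      show "w x \<le> 4 / d\<^sup>2 * \<bar>x\<bar>\<^sup>2"
      proof (cases "x < - (d / 2)")
        case True
        then show ?thesis
          using sq[of "1 / 2" "1 / 4"] d by (simp add: w_def indicator_def power2_eq_square field_simps)
      next
        case False
        show ?thesis
        proof (cases "x < - (7 / 20 * d)")
          case True
          then show ?thesis
            using sq[of "7 / 20" "49 / 400"] False d
            by (simp add: w_def indicator_def power2_eq_square field_simps)
        qed (use False d in \<open>simp add: w_def indicator_def\<close>)
      qed
    qed (use d int in \<open>auto simp: w_def indicator_def\<close>)
    \<comment> \<open>The mean of arm \<open>i\<close> is \<open>- d\<close>, so the jump at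
      \<open>- 7 / 20 * d\<close> is a deviation of \<open>13 / 20 * d\<close>.\<close>
    also have "(\<Sum>s = 1..n-1. \<integral>\<omega>. 1 - w (emp_mean Y i s \<omega>) \<partial>M) =
        51 / 100 * (\<Sum>s = 1..n-1. prob (T (d / 2) s)) + 49 / 100 * (\<Sum>s = 1..n-1. prob (T (13 / 20 * d) s))"
    proof -
      have "(\<integral>\<omega>. 1 - w (emp_mean Y i s \<omega>) \<partial>M) = 51 / 100 * prob (T (d / 2) s) + 49 / 100 * prob (T (13 / 20 * d) s)" for s
      proof -
        have [measurable]: "emp_mean Y i s \<in> borel_measurable M" by (rule emp_mean_measurable[OF iK])
        have [measurable]: "T u s \<in> sets M" for u unfolding T_def by measurable
        have int_T: "integrable M (indicat_real (T u s))" for u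
          by (intro integrable_real_indicator) (simp_all add: emeasure_eq_measure)
        have "(\<integral>\<omega>. 1 - w (emp_mean Y i s \<omega>) \<partial>M) =
            (\<integral>\<omega>. 51 / 100 * indicator (T (d / 2) s) \<omega> + 49 / 100 * indicator (T (13 / 20 * d) s) \<omega> \<partial>M)"
          by (intro Bochner_Integration.integral_cong) (auto simp: w_def T_def indicator_def m)
        also have "\<dots> = 51 / 100 * prob (T (d / 2) s) + 49 / 100 * prob (T (13 / 20 * d) s)"
          using int_T by simp
        finally show ?thesis .
      qed
      then show ?thesis by (simp add: sum.distrib sum_distrib_left)
    qed
    also have "\<dots> \<le> 51 / 100 * (2 / (d / 2)\<^sup>2) + 49 / 100 * (2 / (13 / 20 * d)\<^sup>2)"
      unfolding T_def using d by (intro add_mono mult_left_mono sum_upper_tail_le iK sg) auto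
    also have "4 / d\<^sup>2 * (\<Sum>s = 1..n-1. \<integral>\<omega>. \<bar>emp_mean Y j s \<omega>\<bar>\<^sup>2 *
          indicator {..< - 0 / 2} (emp_mean Y j s \<omega>) \<partial>M) \<le> 4 / d\<^sup>2 * (v * (ln (real n) + 13 / 22))"
      by (intro mult_left_mono S) auto
    finally have "(\<Sum>t = 1..n. prob {\<omega> \<in> space M. I t \<omega> = i}) \<le>
        1 + (51 / 100 * (2 / (d / 2)\<^sup>2) + 49 / 100 * (2 / (13 / 20 * d)\<^sup>2)) +
        4 / d\<^sup>2 * (v * (ln (real n) + 13 / 22))" by simp
    \<comment> \<open>In units of \<open>1 / d\<^sup>2\<close> the terms are 4.08 and about 2.3195,
      just below 6.4 in total.\<close>
    also have "51 / 100 * (2 / (d / 2)\<^sup>2) + 49 / 100 * (2 / (13 / 20 * d)\<^sup>2) \<le> 32 / 5 / d\<^sup>2"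
      using d by (simp add: power_divide power_mult_distrib field_simps)
    finally have "d * (\<Sum>t = 1..n. prob {\<omega> \<in> space M. I t \<omega> = i}) \<le>
        d * (1 + 32 / 5 / d\<^sup>2 + 4 / d\<^sup>2 * (v * (ln (real n) + 13 / 22)))"
      using d by (intro mult_left_mono) auto
    also have "\<dots> = d + (32 / 5 + 4 * (v * (ln (real n) + 13 / 22))) / d"
      using d by (simp add: power2_eq_square field_simps)
    also have "\<dots> \<le> d + max 1 v * (4 * ln (9 * real n)) / d"
    proof (intro add_left_mono divide_right_mono)
      have ln_n: "ln (real n) \<ge> 0" using n by simp
      have "ln (9 * real n) = 2 * ln 3 + ln (real n)"
        using n ln_realpow[of 3 2] by (simp add: ln_mult)
      \<comment> \<open>The term \<open>8 * ln 3\<close> coming from the 9 pays for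
        \<open>32 / 5\<close> and for \<open>13 / 22\<close> taken four times, with almost no slack.
        The factor \<open>max 1 v\<close> then covers both the part proportional to \<open>v\<close>
        and the part free of it.\<close>
      then have "32 / 5 + 4 * (ln (real n) + 13 / 22) \<le> 4 * ln (9 * real n)"
        using ln_3_ge by simp
      then have "max 1 v * (32 / 5 + 4 * (ln (real n) + 13 / 22)) \<le> max 1 v * (4 * ln (9 * real n))"
        by (intro mult_left_mono) auto
      moreover have "v * (ln (real n) + 13 / 22) \<le> max 1 v * (ln (real n) + 13 / 22)"
        using ln_n by (intro mult_right_mono) auto
      moreover have "32 / 5 \<le> max 1 v * (32 / 5)" by simp
      ultimately show "32 / 5 + 4 * (v * (ln (real n) + 13 / 22)) \<le> max 1 v * (4 * ln (9 * real n))"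
        by (simp add: distrib_left)
    qed (use d in simp)
    finally show "gap K \<nu> i * (\<Sum>t = 1..n. prob {\<omega> \<in> space M. I t \<omega> = i}) \<le>
        gap K \<nu> i + max 1 v * (4 * ln (9 * real n) / gap K \<nu> i)"
      by (simp add: d_def)
  qed
qed

theorem theorem2:
  fixes M :: "'a measure" and K :: nat and \<nu> :: "nat \<Rightarrow> real measure"
    and Y :: "nat \<Rightarrow> nat \<Rightarrow> 'a \<Rightarrow> real"
    and N :: "'u measure" and U :: "'a \<Rightarrow> 'u" and I :: "nat \<Rightarrow> 'a \<Rightarrow> nat" and \<epsilon> :: real
  assumes "stochastic_bandit M K \<nu> Y"
    and "\<forall>i\<in>{1..K}. sub_gaussian (\<nu> i)"
    and "opt_mean K \<nu> = 0"
  shows "(0 < \<epsilon> \<and> ereal \<epsilon> \<le> min 1 (min_gap K \<nu>) \<and>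
            potential_policy M K \<nu> Y N U I \<epsilon> (\<lambda>x. x\<^sup>2) \<longrightarrow>
          (\<forall>n\<ge>1. regret M K \<nu> I n \<le>
            (\<Sum>i\<in>suboptimal_arms K \<nu>. gap K \<nu> i + 32 / gap K \<nu> i * ln (5 / \<epsilon>))))
       \<and> (\<epsilon> = 0 \<and> potential_policy M K \<nu> Y N U I \<epsilon> (\<lambda>x. x\<^sup>2) \<longrightarrow>
          (\<forall>star\<in>{1..K}. mean (\<nu> star) = opt_mean K \<nu> \<longrightarrow>
            (let v = (\<integral>\<omega>. (Y star 1 \<omega>)\<^sup>2 \<partial>M) in
              \<forall>n\<ge>1. regret M K \<nu> I n \<le>
                (\<Sum>i\<in>suboptimal_arms K \<nu>.
                  gap K \<nu> i + max 1 v * (4 * ln (9 * real n) / gap K \<nu> i)))))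
       \<and> (0 < \<epsilon> \<and> ereal \<epsilon> \<le> min 1 (min_gap K \<nu>) \<and>
            potential_policy M K \<nu> Y N U I \<epsilon> (\<lambda>x. x\<^sup>2 / ln (4 * x / \<epsilon>)) \<longrightarrow>
          (\<forall>n\<ge>1. regret M K \<nu> I n \<le>
            (\<Sum>i\<in>suboptimal_arms K \<nu>. gap K \<nu> i +
              32 * ln (2 * gap K \<nu> i / \<epsilon>) / gap K \<nu> i * (3 + ln (ln (4 / \<epsilon>))))))"
proof (intro conjI impI allI ballI)
  interpret stochastic_bandit M K \<nu> Y by fact
  have sg: "\<And>i. i \<in> {1..K} \<Longrightarrow> sub_gaussian (\<nu> i)" using assms(2) by blast
  fix n :: nat assume "n \<ge> 1"
  {
    assume "0 < \<epsilon> \<and> ereal \<epsilon> \<le> min 1 (min_gap K \<nu>) \<and>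
      potential_policy M K \<nu> Y N U I \<epsilon> (\<lambda>x. x\<^sup>2)"
    then show "regret M K \<nu> I n \<le>
        (\<Sum>i\<in>suboptimal_arms K \<nu>. gap K \<nu> i + 32 / gap K \<nu> i * ln (5 / \<epsilon>))"
      by (intro regret_square_potential[OF _ sg assms(3)]) auto
  }
  {
    assume "0 < \<epsilon> \<and> ereal \<epsilon> \<le> min 1 (min_gap K \<nu>) \<and>
      potential_policy M K \<nu> Y N U I \<epsilon> (\<lambda>x. x\<^sup>2 / ln (4 * x / \<epsilon>))"
    then show "regret M K \<nu> I n \<le> (\<Sum>i\<in>suboptimal_arms K \<nu>. gap K \<nu> i +
        32 * ln (2 * gap K \<nu> i / \<epsilon>) / gap K \<nu> i * (3 + ln (ln (4 / \<epsilon>))))"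
      by (intro regret_square_over_ln_potential[OF _ sg assms(3)]) auto
  }
next
  fix star
  have sg: "\<And>i. i \<in> {1..K} \<Longrightarrow> sub_gaussian (\<nu> i)" using assms(2) by blast
  assume pol: "\<epsilon> = 0 \<and> potential_policy M K \<nu> Y N U I \<epsilon> (\<lambda>x. x\<^sup>2)"
    and star: "star \<in> {1..K}" "mean (\<nu> star) = opt_mean K \<nu>"
  then have "potential_policy M K \<nu> Y N U I 0 (\<lambda>x. x\<^sup>2)" "mean (\<nu> star) = 0"
    using assms(3) by auto
  from regret_square_potential_eps_zero[OF this(1) sg assms(3) star(1) this(2) refl]
  show "let v = (\<integral>\<omega>. (Y star 1 \<omega>)\<^sup>2 \<partial>M) in
      \<forall>n\<ge>1. regret M K \<nu> I n \<le>
        (\<Sum>i\<in>suboptimal_arms K \<nu>.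
          gap K \<nu> i + max 1 v * (4 * ln (9 * real n) / gap K \<nu> i))"
    unfolding Let_def by blast
qed

end
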